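(* $\mathrm{SSCM}(3,1;4;3,3)=\mathrm{RE}$. That is, a language is recursively enumerable if and only if it is generated by a simple semi-conditional matrix grammar of degree $(3,1)$ with at most $4$ nonterminals, at most $3$ conditional matrices, and all matrices of length at most $3$.
   Context: A semi-conditional matrix (SCM) grammar is a quadruple $G=(V,T,M,S)$ with the following components. - $V$ is a finite alphabet and $T\subsetneq V$ is the set of terminals. - $N=V\setminus T$ is the set of nonterminals and $S\in N$ is the start symbol. - $M$ is a finite set of matrices of the form $r=[(A_1\to x_1),\dots,(A_\ell\to x_\ell),P,F]$, where $\ell\ge 1$, $A_k\in N$, $x_k\in V^*$, and $P,F\in V^+\cup\{\emptyset\}$. Here $\emptyset\notin V$ is a special symbol meaning that the condition is absent, and $|\emptyset|=0$. The number $\ell$ is the length of $r$. A matrix is classified as follows: - unconditional if $P=F=\emptyset$, and conditional otherwise; - simple if at least one of $P,F$ equals $\emptyset$, and non-simple if both $P\neq\emptyset$ and $F\neq\emptyset$. For $x,y\in V^*$ we write $x\Rightarrow_r y$ iff all of the following hold: 1. if $P\neq\emptyset$ then $P$ is a subword (factor) of $x$; 2. if $F\neq\emptyset$ then $F$ is not a subword of $x$; 3. there are words $x=y_0,y_1,\dots,y_\ell=y$ such that $y_k$ is obtained from $y_{k-1}$ by replacing one occurrence of $A_k$ by $x_k$. $\Rightarrow_G$ is the union of the relations $\Rightarrow_r$ over $r\in M$, and $L(G)=\{y\in T^*: S\Rightarrow_G^* y\}$. $G$ has degree $(i,j)$ if every matrix satisfies $|P|\le i$ and $|F|\le j$. $\mathrm{SCM}(i,j;n;m,\ell,s)$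 denotes the family of languages $L(G)$ of SCM grammars $G$ that satisfy all of the following: - $G$ has degree $(i,j)$; - $|N|\le n$; - $G$ has at most $m$ conditional matrices; - every matrix of $G$ has length at most $\ell$; - $G$ has at most $s$ non-simple matrices. A $*$ in a parameter position means that parameter is unbounded. $\mathrm{SSCM}(i,j;n;m,\ell)=\mathrm{SCM}(i,j;n;m,\ell,0)$, i.e., all matrices are simple. $\mathrm{RE}$ is the class of recursively enumerable languages. *)

theory Defs
  imports Main
begin

text \<open>Grammar symbols: terminals of an arbitrary type 't, nonterminals named by naturals.
  A grammar's alphabet V is a finite set of such symbols; its terminals are the Tm-symbols
  in V and its nonterminals N are the Nt-symbols in V.\<close>

datatype 't sym = Tm 't | Nt nat

definition factor :: "'a list \<Rightarrow> 'a list \<Rightarrow> bool" where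
  "factor w x \<longleftrightarrow> (\<exists>u v. x = u @ w @ v)"

text \<open>A matrix [(A1->x1),...,(Al->xl), P, F]; the option None encodes the symbol \<emptyset>.\<close>
record 't matrix =
  mrules :: "(nat \<times> 't sym list) list"
  mP :: "'t sym list option"
  mF :: "'t sym list option"

record 't scm_grammar =
  gV :: "'t sym set"
  gM :: "'t matrix set"
  gS :: nat

definition cond_len :: "'a list option \<Rightarrow> nat" where
  "cond_len c = (case c of None \<Rightarrow> 0 | Some w \<Rightarrow> length w)"

definition nonterms :: "'t sym set \<Rightarrow> nat set" where
  "nonterms V = {A. Nt A \<in> V}"

definition wf_cond :: "'t sym set \<Rightarrow> 't sym list option \<Rightarrow> bool" where
  "wf_cond V c = (case c of None \<Rightarrow> True | Some w \<Rightarrow> w \<noteq> [] \<and> set w \<subseteq> V)"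

definition wf_matrix :: "'t sym set \<Rightarrow> 't matrix \<Rightarrow> bool" where
  "wf_matrix V r \<longleftrightarrow> mrules r \<noteq> [] \<and>
     (\<forall>(A, x) \<in> set (mrules r). Nt A \<in> V \<and> set x \<subseteq> V) \<and>
     wf_cond V (mP r) \<and> wf_cond V (mF r)"

definition scm_grammar :: "'t scm_grammar \<Rightarrow> bool" where
  "scm_grammar G \<longleftrightarrow> finite (gV G) \<and> Nt (gS G) \<in> gV G \<and>
     finite (gM G) \<and> (\<forall>r \<in> gM G. wf_matrix (gV G) r)"

definition conditional :: "'t matrix \<Rightarrow> bool" where
  "conditional r \<longleftrightarrow> \<not> (mP r = None \<and> mF r = None)"

definition non_simple :: "'t matrix \<Rightarrow> bool" where
  "non_simple r \<longleftrightarrow> mP r \<noteq> None \<and> mF r \<noteq> None"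

fun apply_rules :: "(nat \<times> 't sym list) list \<Rightarrow> 't sym list \<Rightarrow> 't sym list \<Rightarrow> bool" where
  "apply_rules [] x y \<longleftrightarrow> x = y"
| "apply_rules ((A, w) # rs) x y \<longleftrightarrow>
     (\<exists>u v. x = u @ [Nt A] @ v \<and> apply_rules rs (u @ w @ v) y)"

definition matrix_step :: "'t matrix \<Rightarrow> 't sym list \<Rightarrow> 't sym list \<Rightarrow> bool" where
  "matrix_step r x y \<longleftrightarrow>
     (case mP r of None \<Rightarrow> True | Some P \<Rightarrow> factor P x) \<and>
     (case mF r of None \<Rightarrow> True | Some F \<Rightarrow> \<not> factor F x) \<and>
     apply_rules (mrules r) x y"

definition scm_step :: "'t scm_grammar \<Rightarrow> 't sym list \<Rightarrow> 't sym list \<Rightarrow> bool" where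
  "scm_step G x y \<longleftrightarrow> (\<exists>r \<in> gM G. matrix_step r x y)"

definition scm_lang :: "'t scm_grammar \<Rightarrow> 't list set" where
  "scm_lang G = {w. (scm_step G)\<^sup>*\<^sup>* [Nt (gS G)] (map Tm w)}"

text \<open>SCM(i,j;n;m,l,s); None encodes the unbounded parameter *.\<close>
definition bnd :: "nat option \<Rightarrow> nat \<Rightarrow> bool" where
  "bnd b k = (case b of None \<Rightarrow> True | Some c \<Rightarrow> k \<le> c)"

definition SCM :: "nat option \<Rightarrow> nat option \<Rightarrow> nat option \<Rightarrow> nat option \<Rightarrow> nat option
                   \<Rightarrow> nat option \<Rightarrow> 't list set set" where
  "SCM i j n m l s = {L. \<exists>G. scm_grammar G \<and>
     (\<forall>r \<in> gM G. bnd i (cond_len (mP r)) \<and> bnd j (cond_len (mF r))) \<and>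
     bnd n (card (nonterms (gV G))) \<and>
     bnd m (card {r \<in> gM G. conditional r}) \<and>
     (\<forall>r \<in> gM G. bnd l (length (mrules r))) \<and>
     bnd s (card {r \<in> gM G. non_simple r}) \<and>
     scm_lang G = L}"

definition SSCM :: "nat option \<Rightarrow> nat option \<Rightarrow> nat option \<Rightarrow> nat option \<Rightarrow> nat option
                   \<Rightarrow> 't list set set" where
  "SSCM i j n m l = SCM i j n m l (Some 0)"

record 't ps_grammar =
  pV :: "'t sym set"
  pR :: "('t sym list \<times> 't sym list) set"
  pS :: nat

definition ps_grammar :: "'t ps_grammar \<Rightarrow> bool" where
  "ps_grammar G \<longleftrightarrow> finite (pV G) \<and> Nt (pS G) \<in> pV G \<and> finite (pR G) \<and>
     (\<forall>(\<alpha>, \<beta>) \<in> pR G. set \<alpha> \<subseteq> pV G \<and> set \<beta> \<subseteq> pV G \<and> (\<exists>A. Nt A \<in> set \<alpha>))"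

definition ps_step :: "'t ps_grammar \<Rightarrow> 't sym list \<Rightarrow> 't sym list \<Rightarrow> bool" where
  "ps_step G x y \<longleftrightarrow> (\<exists>(\<alpha>, \<beta>) \<in> pR G. \<exists>u v. x = u @ \<alpha> @ v \<and> y = u @ \<beta> @ v)"

definition ps_lang :: "'t ps_grammar \<Rightarrow> 't list set" where
  "ps_lang G = {w. (ps_step G)\<^sup>*\<^sup>* [Nt (pS G)] (map Tm w)}"

definition RE :: "'t list set set" where
  "RE = {L. \<exists>G. ps_grammar G \<and> ps_lang G = L}"

end

theory Submission
  imports Defs
begin

text \<open>A phrase structure grammar simulates an SCM grammar with a control symbol that walks through
  the sentential form.

  Conversely, a derivation of a phrase structure grammar is a run of a queue that holds the rotated
  sentential form. The run succeeds iff the word \<open>U\<close> of everything pushed equals the word \<open>V\<close> of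
  everything popped. With four nonterminals \<open>A\<close>, \<open>B\<close>, \<open>C\<close>, \<open>S\<close>, the grammar first generates
  \<open>w C U S V'\<close>, where \<open>w\<close> is the output, \<open>V'\<close> is the mirror image of \<open>V\<close>, and both words are coded
  by runs of \<open>B\<close> separated by \<open>A\<close>. Then \<open>C\<close> moves to the centre, and the equality is tested by
  cancelling letters next to it: two equal letters and \<open>C\<close> are replaced by \<open>S\<close>, and only if the
  three occurrences of \<open>S\<close> form a block \<open>SSS\<close> they are replaced by \<open>C\<close>. As \<open>C\<close> occurs exactly once,
  there are never more than three marked symbols, so that a wrong guess blocks the derivation. The
  second conditional matrix introduces the initial word in the absence of \<open>B\<close>, and a \<open>B\<close> is present
  whenever \<open>C\<close> is, except in the start word.\<close>

section \<open>Phrase structure grammars simulate SCM grammars\<close>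

definition rw :: "('a list \<times> 'a list) set \<Rightarrow> 'a list \<Rightarrow> 'a list \<Rightarrow> bool" where
  "rw R x y \<longleftrightarrow> (\<exists>\<alpha> \<beta> u v. (\<alpha>, \<beta>) \<in> R \<and> x = u @ \<alpha> @ v \<and> y = u @ \<beta> @ v)"

lemma ps_step_eq_rw: "ps_step G = rw (pR G)"
  by (auto simp: ps_step_def rw_def fun_eq_iff)

lemma rwI: "(\<alpha>, \<beta>) \<in> R \<Longrightarrow> rw R (u @ \<alpha> @ v) (u @ \<beta> @ v)"
  unfolding rw_def by blast

lemma rw_map: "rw R x y \<Longrightarrow> rw (map_prod (map h) (map h) ` R) (map h x) (map h y)"
  unfolding rw_def by (auto simp: image_iff) (metis map_prod_simp)

text \<open>Since \<open>h\<close> is injective on \<open>A\<close>, the factor of \<open>x\<close>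
  whose image matches \<open>map h \<alpha>\<close> is \<open>\<alpha>\<close> itself, so a step on
  images is the image of a step. The result stays within \<open>A\<close>, as iteration
  requires.\<close>

lemma rw_map_inv:
  assumes "rw (map_prod (map h) (map h) ` R) (map h x) y"
    and inj: "inj_on h A" and x: "set x \<subseteq> A"
    and R: "\<And>\<alpha> \<beta>. (\<alpha>, \<beta>) \<in> R \<Longrightarrow> set \<alpha> \<subseteq> A \<and> set \<beta> \<subseteq> A"
  shows "\<exists>y'. y = map h y' \<and> set y' \<subseteq> A \<and> rw R x y'"
proof -
  obtain \<alpha> \<beta> u v where r: "(\<alpha>, \<beta>) \<in> R" and eq: "map h x = u @ map h \<alpha> @ v" "y = u @ map h \<beta> @ v"
    using assms(1) unfolding rw_def by auto
  obtain u' z v' where d: "x = u' @ z @ v'" "u = map h u'" "map h \<alpha> = map h z" "v = map h v'"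
    using eq(1) by (auto simp: map_eq_append_conv append_eq_map_conv)
  have "set \<alpha> \<union> set z \<subseteq> A" using R[OF r] x d(1) by auto
  then have "\<alpha> = z" using map_inj_on[OF d(3)] inj_on_subset[OF inj] by blast
  then show ?thesis using d r eq R[OF r] x
    by (intro exI[of _ "u' @ \<beta> @ v'"]) (auto simp: rw_def)
qed

text \<open>This frees the simulation from naming nonterminals by naturals: only finitely many occur
  in \<open>A\<close>, so they can be numbered injectively, and derivations correspond step by
  step.\<close>

lemma rewriting_lang_in_RE:
  fixes R :: "(('t + 'n) list \<times> ('t + 'n) list) set"
  assumes fin: "finite R" "finite A" and s: "Inr s \<in> A"
    and R: "\<And>\<alpha> \<beta>. (\<alpha>, \<beta>) \<in> R \<Longrightarrow> set \<alpha> \<subseteq> A \<and> set \<beta> \<subseteq> A \<and> (\<exists>n. Inr n \<in> set \<alpha>)"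
  shows "{w. (rw R)\<^sup>*\<^sup>* [Inr s] (map Inl w)} \<in> RE"
proof -
  have "finite (Inr -` A :: 'n set)" using fin by (simp add: finite_vimageI)
  then obtain f :: "'n \<Rightarrow> nat" where f: "inj_on f (Inr -` A)"
    using finite_imp_inj_to_nat_seg by metis
  define h :: "'t + 'n \<Rightarrow> 't sym" where "h = case_sum Tm (\<lambda>n. Nt (f n))"
  have inj: "inj_on h A"
    using f by (auto simp: inj_on_def h_def split: sum.splits)
  define G where "G = \<lparr>pV = h ` A, pR = map_prod (map h) (map h) ` R, pS = f s\<rparr>"
  have hs: "h (Inr s) = Nt (f s)" "\<And>w. map h (map Inl w) = map Tm w" by (auto simp: h_def)
  have nt: "\<exists>k. Nt k \<in> h ` set \<alpha>" if "(\<alpha>, \<beta>) \<in> R" for \<alpha> \<beta>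
    using R[OF that] by (force simp: h_def image_iff)
  have nts: "Nt (f s) \<in> h ` A" using s hs(1) by (metis imageI)
  have G: "ps_grammar G"
  proof -
    have "set (map h \<alpha>) \<subseteq> h ` A \<and> set (map h \<beta>) \<subseteq> h ` A \<and> (\<exists>k. Nt k \<in> set (map h \<alpha>))"
      if "(\<alpha>, \<beta>) \<in> R" for \<alpha> \<beta>
      using R[OF that] nt[OF that] by auto
    then show ?thesis unfolding ps_grammar_def G_def using fin nts by fastforce
  qed
  have fwd: "(ps_step G)\<^sup>*\<^sup>* (map h x) (map h y)" if "(rw R)\<^sup>*\<^sup>* x y" for x y
    using that
  proof induction
    case (step y z)
    have "ps_step G (map h y) (map h z)"
      using rw_map[OF step(2)] by (simp add: ps_step_eq_rw G_def)
    with step(3) show ?case by (rule rtranclp.rtrancl_into_rtrancl)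
  qed simp
  have bwd: "\<exists>y'. y = map h y' \<and> set y' \<subseteq> A \<and> (rw R)\<^sup>*\<^sup>* [Inr s] y'"
    if "(ps_step G)\<^sup>*\<^sup>* (map h [Inr s]) y" for y
    using that
  proof induction
    case base
    then show ?case using s by (intro exI[of _ "[Inr s]"]) auto
  next
    case (step y z)
    then obtain y' where y': "y = map h y'" "set y' \<subseteq> A" "(rw R)\<^sup>*\<^sup>* [Inr s] y'" by blast
    have "rw (map_prod (map h) (map h) ` R) (map h y') z"
      using step(2) y'(1) by (simp add: ps_step_eq_rw G_def)
    then obtain z' where "z = map h z'" "set z' \<subseteq> A" "rw R y' z'"
      using rw_map_inv[OF _ inj y'(2)] R by blast
    with y'(3) show ?case by (blast intro: rtranclp.rtrancl_into_rtrancl)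
  qed
  have h_inv: "y = map Inl w" if "map h y = map Tm w" for y and w :: "'t list"
    using that
    by (induction y arbitrary: w) (auto simp: h_def Cons_eq_map_conv map_eq_Cons_conv split: sum.splits)
  have st: "[Nt (pS G)] = map h [Inr s]" by (simp add: G_def hs)
  have "ps_lang G = {w. (rw R)\<^sup>*\<^sup>* [Inr s] (map Inl w)}"
  proof (intro set_eqI iffI)
    fix w assume "w \<in> ps_lang G"
    then have "(ps_step G)\<^sup>*\<^sup>* (map h [Inr s]) (map Tm w)" by (simp add: ps_lang_def st)
    then obtain y where "map Tm w = map h y" "(rw R)\<^sup>*\<^sup>* [Inr s] y" using bwd by blast
    with h_inv[of y w] show "w \<in> {w. (rw R)\<^sup>*\<^sup>* [Inr s] (map Inl w)}" by simp
  next
    fix w assume "w \<in> {w. (rw R)\<^sup>*\<^sup>* [Inr s] (map Inl w)}"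
    with fwd have "(ps_step G)\<^sup>*\<^sup>* (map h [Inr s]) (map h (map Inl w))" by blast
    then show "w \<in> ps_lang G" unfolding ps_lang_def st hs(2) by simp
  qed
  with G show ?thesis unfolding RE_def by blast
qed

lemma apply_rules_alphabet:
  assumes "apply_rules rs x y" "set x \<subseteq> V" "\<forall>(A, w) \<in> set rs. set w \<subseteq> V"
  shows "set y \<subseteq> V"
  using assms
proof (induction rs arbitrary: x)
  case (Cons r rs)
  obtain A w where [simp]: "r = (A, w)" by (cases r)
  from Cons.prems(1) obtain u v where *: "x = u @ [Nt A] @ v" "apply_rules rs (u @ w @ v) y"
    by auto
  have "set (u @ w @ v) \<subseteq> V" using Cons.prems *(1) by auto
  from Cons.IH[OF *(2) this] Cons.prems show ?case by auto
qed simp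

lemma scm_grammar_ruleD:
  assumes "scm_grammar G" "r \<in> gM G" "(A, w) \<in> set (mrules r)"
  shows "Nt A \<in> gV G" "set w \<subseteq> gV G"
  using assms unfolding scm_grammar_def wf_matrix_def by fast+

lemma scm_reachable_alphabet:
  assumes "scm_grammar G" "(scm_step G)\<^sup>*\<^sup>* [Nt (gS G)] x"
  shows "set x \<subseteq> gV G"
  using assms(2)
proof induction
  case base
  then show ?case using assms(1) by (simp add: scm_grammar_def)
next
  case (step y z)
  then obtain r where r: "r \<in> gM G" "apply_rules (mrules r) y z"
    by (auto simp: scm_step_def matrix_step_def)
  with assms(1) have "\<forall>(A, w) \<in> set (mrules r). set w \<subseteq> gV G"
    using scm_grammar_ruleD(2) by fast
  then show ?case using apply_rules_alphabet r(2) step.IH by blast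
qed

text \<open>The sentential form \<open>x\<close> is kept between end markers, together with one control symbol that
  walks through \<open>x\<close>: \<open>Pos r\<close> looks for the permitting factor of the matrix \<open>r\<close>, \<open>Neg r\<close> returns to
  the left end, \<open>Swp r\<close> crosses \<open>x\<close> while avoiding the forbidden symbol, and \<open>App rs\<close> applies the
  remaining rules \<open>rs\<close>. \<open>App []\<close> is the idle state.\<close>

datatype 't ctl = Orig nat | Lft | Rgt | Ini | Fin
  | Pos "'t matrix" | Neg "'t matrix" | Swp "'t matrix" | App "(nat \<times> 't sym list) list"

fun emb :: "'t sym \<Rightarrow> 't + 't ctl" where
  "emb (Tm a) = Inl a"
| "emb (Nt A) = Inr (Orig A)"

lemma emb_inj [simp]: "emb c = emb d \<longleftrightarrow> c = d"
  by (cases c; cases d) auto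

lemma emb_eq_Inr: "emb c = Inr q \<longleftrightarrow> (\<exists>A. q = Orig A \<and> c = Nt A)"
  by (cases c) auto

definition required :: "'t matrix \<Rightarrow> 't sym list" where
  "required r = (case mP r of None \<Rightarrow> [] | Some w \<Rightarrow> w)"

definition forbidden :: "'t matrix \<Rightarrow> 't sym set" where
  "forbidden r = (case mF r of None \<Rightarrow> {} | Some w \<Rightarrow> set w)"

text \<open>A forbidding word of length at most 1 is a single symbol, so its absence can be checked
  letter by letter. An absent permitting condition becomes the empty word, a factor of every
  word.\<close>

lemma matrix_step_iff:
  assumes "cond_len (mF r) \<le> 1" "wf_cond V (mF r)"
  shows "matrix_step r x y \<longleftrightarrow>
    factor (required r) x \<and> set x \<inter> forbidden r = {} \<and> apply_rules (mrules r) x y"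
proof -
  have P: "(case mP r of None \<Rightarrow> True | Some P \<Rightarrow> factor P x) \<longleftrightarrow> factor (required r) x"
    by (auto simp: required_def factor_def split: option.splits)
  have F: "(case mF r of None \<Rightarrow> True | Some F \<Rightarrow> \<not> factor F x) \<longleftrightarrow> set x \<inter> forbidden r = {}"
  proof (cases "mF r")
    case (Some w)
    then obtain f where "w = [f]" using assms
      by (cases w) (auto simp: cond_len_def wf_cond_def)
    then show ?thesis using Some by (auto simp: forbidden_def factor_def in_set_conv_decomp)
  qed (simp add: forbidden_def)
  show ?thesis unfolding matrix_step_def P F ..
qed

text \<open>The possible arguments of \<open>App\<close>: what is left of a matrix after some of its
  rules. The list \<open>[]\<close> is added separately for the idle state, which must exist even
  without any matrix.\<close>

definition rule_suffixes :: "'t scm_grammar \<Rightarrow> (nat \<times> 't sym list) list set" where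
  "rule_suffixes G =
     insert [] (\<Union>r\<in>gM G. (\<lambda>k. drop k (mrules r)) ` {..length (mrules r)})"

lemma mrules_suffix: "r \<in> gM G \<Longrightarrow> mrules r \<in> rule_suffixes G"
  unfolding rule_suffixes_def by (auto intro!: bexI[of _ r] image_eqI[of _ _ 0])

lemma rule_suffixes_tl:
  assumes "p # rs \<in> rule_suffixes G"
  shows "rs \<in> rule_suffixes G"
proof -
  obtain r k where r: "r \<in> gM G" "p # rs = drop k (mrules r)"
    using assms by (auto simp: rule_suffixes_def)
  then have "rs = drop (Suc k) (mrules r)" "k < length (mrules r)"
    by (metis drop_Suc list.sel(3) tl_drop) (metis drop_all leI list.distinct(1) r(2))
  with r(1) show ?thesis unfolding rule_suffixes_def
    by (auto intro!: bexI[of _ r] image_eqI[of _ _ "Suc k"])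
qed

lemma rule_suffixes_set:
  "rs \<in> rule_suffixes G \<Longrightarrow> p \<in> set rs \<Longrightarrow> \<exists>r\<in>gM G. p \<in> set (mrules r)"
  unfolding rule_suffixes_def by (auto dest: in_set_dropD)

text \<open>Control symbols that may wander freely in both directions. \<open>Swp\<close> is
  excluded, since a sweep has to inspect every symbol on its way.\<close>

definition movers :: "'t scm_grammar \<Rightarrow> 't ctl set" where
  "movers G = Pos ` gM G \<union> Neg ` gM G \<union> App ` rule_suffixes G"

text \<open>\<open>Swp\<close> starts only at \<open>Lft\<close> and ends only at
  \<open>Rgt\<close>, so it inspects the whole form. Likewise \<open>Fin\<close> starts at the right
  end and passes terminals only; it reaches \<open>Lft\<close>, where both vanish, only if the form
  is terminal.\<close>

inductive_set sim_rules :: "'t scm_grammar \<Rightarrow> (('t + 't ctl) list \<times> ('t + 't ctl) list) set"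
  for G where
  start: "([Inr Ini], [Inr Lft, Inr (App []), Inr (Orig (gS G)), Inr Rgt]) \<in> sim_rules G"
| move_right: "q \<in> movers G \<Longrightarrow> c \<in> gV G \<Longrightarrow> ([Inr q, emb c], [emb c, Inr q]) \<in> sim_rules G"
| move_left: "q \<in> movers G \<Longrightarrow> c \<in> gV G \<Longrightarrow> ([emb c, Inr q], [Inr q, emb c]) \<in> sim_rules G"
| select: "r \<in> gM G \<Longrightarrow> ([Inr (App [])], [Inr (Pos r)]) \<in> sim_rules G"
| check_pos: "r \<in> gM G \<Longrightarrow> (Inr (Pos r) # map emb (required r),
      Inr (Neg r) # map emb (required r)) \<in> sim_rules G"
| sweep_start: "r \<in> gM G \<Longrightarrow> ([Inr Lft, Inr (Neg r)], [Inr Lft, Inr (Swp r)]) \<in> sim_rules G"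
| sweep: "r \<in> gM G \<Longrightarrow> c \<in> gV G \<Longrightarrow> c \<notin> forbidden r \<Longrightarrow>
      ([Inr (Swp r), emb c], [emb c, Inr (Swp r)]) \<in> sim_rules G"
| sweep_end: "r \<in> gM G \<Longrightarrow>
      ([Inr (Swp r), Inr Rgt], [Inr (App (mrules r)), Inr Rgt]) \<in> sim_rules G"
| app: "(A, w) # rs \<in> rule_suffixes G \<Longrightarrow>
      ([Inr (App ((A, w) # rs)), Inr (Orig A)], Inr (App rs) # map emb w) \<in> sim_rules G"
| stop: "([Inr (App []), Inr Rgt], [Inr Fin]) \<in> sim_rules G"
| stop_sweep: "Tm a \<in> gV G \<Longrightarrow> ([Inl a, Inr Fin], [Inr Fin, Inl a]) \<in> sim_rules G"
| stop_end: "([Inr Lft, Inr Fin], []) \<in> sim_rules G"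

definition sim_alphabet :: "'t scm_grammar \<Rightarrow> ('t + 't ctl) set" where
  "sim_alphabet G = emb ` gV G \<union>
     Inr ` ({Lft, Rgt, Ini, Fin} \<union> movers G \<union> Swp ` gM G)"

lemma finite_sim_alphabet: "scm_grammar G \<Longrightarrow> finite (sim_alphabet G)"
  by (auto simp: sim_alphabet_def scm_grammar_def movers_def rule_suffixes_def)

lemma sim_rules_alphabet:
  assumes G: "scm_grammar G" and "(\<alpha>, \<beta>) \<in> sim_rules G"
  shows "set \<alpha> \<subseteq> sim_alphabet G \<and> set \<beta> \<subseteq> sim_alphabet G \<and> (\<exists>n. Inr n \<in> set \<alpha>)"
proof -
  have app0: "[] \<in> rule_suffixes G" by (simp add: rule_suffixes_def)
  have req: "set (required r) \<subseteq> gV G" if "r \<in> gM G" for r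
  proof -
    have "wf_cond (gV G) (mP r)" using G that by (simp add: scm_grammar_def wf_matrix_def)
    then show ?thesis by (auto simp: required_def wf_cond_def split: option.splits)
  qed
  have rl: "Nt A \<in> gV G \<and> set w \<subseteq> gV G" if "(A, w) # rs \<in> rule_suffixes G" for A w rs
    using rule_suffixes_set[OF that, of "(A, w)"] scm_grammar_ruleD[OF G] by (meson list.set_intros(1))
  have orig: "Inr (Orig A) \<in> emb ` gV G" if "Nt A \<in> gV G" for A
    using that by (metis emb.simps(2) imageI)
  have tm: "Inl a \<in> emb ` gV G" if "Tm a \<in> gV G" for a
    using that by (metis emb.simps(1) imageI)
  have S: "Nt (gS G) \<in> gV G" using G by (simp add: scm_grammar_def)
  show ?thesis using assms(2)
  proof cases
    case start
    then show ?thesis using orig[OF S] app0 by (auto simp: sim_alphabet_def movers_def)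
  next
    case (check_pos r)
    then show ?thesis using req by (auto simp: sim_alphabet_def movers_def)
  next
    case (app A w rs)
    then show ?thesis using rl[OF app(3)] orig rule_suffixes_tl[OF app(3)]
      by (auto simp: sim_alphabet_def movers_def)
  next
    case (stop_sweep a)
    then show ?thesis using tm by (auto simp: sim_alphabet_def)
  qed (auto simp: sim_alphabet_def movers_def mrules_suffix app0)
qed

lemma finite_sim_rules:
  assumes G: "scm_grammar G"
  shows "finite (sim_rules G)"
proof -
  define Ws where "Ws = required ` gM G \<union> snd ` (\<Union>r\<in>gM G. set (mrules r))"
  have "finite Ws" using G by (auto simp: Ws_def scm_grammar_def)
  then obtain N where N: "\<And>w. w \<in> Ws \<Longrightarrow> length w \<le> N"
    by (metis finite_imageI finite_nat_set_iff_bounded_le imageI)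
  \<comment> \<open>The right side of \<open>start\<close> has length 4; every other rule has on
    each side at most two symbols besides a word of \<open>Ws\<close>.\<close>
  let ?W = "{x. set x \<subseteq> sim_alphabet G \<and> length x \<le> N + 4}"
  have "length \<alpha> \<le> N + 4 \<and> length \<beta> \<le> N + 4" if "(\<alpha>, \<beta>) \<in> sim_rules G" for \<alpha> \<beta>
    using that
  proof cases
    case (check_pos r)
    then show ?thesis using N[of "required r"] by (auto simp: Ws_def)
  next
    case (app A w rs)
    then have "w \<in> Ws" using rule_suffixes_set[OF app(3), of "(A, w)"]
      by (force simp: Ws_def)
    then show ?thesis using N[of w] app by auto
  qed auto
  then have "sim_rules G \<subseteq> ?W \<times> ?W" using sim_rules_alphabet[OF G] by fastforce
  moreover have "finite ?W" using finite_lists_length_le[OF finite_sim_alphabet[OF G]] .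
  ultimately show ?thesis by (meson finite_SigmaI finite_subset)
qed

section \<open>Configurations and their unique control symbol\<close>

definition conf :: "'t sym list \<Rightarrow> 't ctl \<Rightarrow> 't sym list \<Rightarrow> ('t + 't ctl) list" where
  "conf u q v = Inr Lft # map emb u @ Inr q # map emb v @ [Inr Rgt]"

definition is_ctl :: "'t ctl \<Rightarrow> bool" where
  "is_ctl q \<longleftrightarrow> (\<forall>A. q \<noteq> Orig A) \<and> q \<noteq> Lft \<and> q \<noteq> Rgt"

lemma is_ctl_simps [simp]:
  "is_ctl (App rs)" "is_ctl (Pos r)" "is_ctl (Neg r)" "is_ctl (Swp r)" "is_ctl Fin" "is_ctl Ini"
  "\<not> is_ctl (Orig A)" "\<not> is_ctl Lft" "\<not> is_ctl Rgt"
  by (auto simp: is_ctl_def)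

lemma is_ctl_notin_emb: "is_ctl q \<Longrightarrow> Inr q \<notin> emb ` X"
  by (auto simp: is_ctl_def image_iff) (metis emb_eq_Inr)

lemma movers_is_ctl: "q \<in> movers G \<Longrightarrow> is_ctl q"
  by (auto simp: movers_def)

text \<open>The letter \<open>x\<close> occurs once, and \<open>y\<close> either is \<open>x\<close>
  or occurs neither in \<open>p\<close> nor in \<open>r\<close>; hence the displayed
  \<open>y\<close> sits at the place of \<open>x\<close>. This locates the left side of a rule by
  its control symbol.\<close>

lemma unique_split:
  assumes "p @ x # r = a @ s @ y # t @ b" "x \<notin> set p" "x \<notin> set r" "y \<in> {x} \<or> y \<notin> set p \<union> set r"
  shows "y = x" "p = a @ s" "r = t @ b"
proof -
  have "y \<in> set (p @ x # r)" unfolding assms(1) by simp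
  with assms(4) show y: "y = x" by auto
  have "p @ x # r = (a @ s) @ x # (t @ b)" using assms(1) y by simp
  then have "p = a @ s \<and> r = t @ b" by (simp only: append_Cons_eq_iff[OF assms(2,3)])
  then show "p = a @ s" "r = t @ b" by auto
qed

lemma conf_split:
  assumes "conf u q v = a @ s @ Inr q' # t @ b" "is_ctl q" "is_ctl q'"
  shows "q' = q" "Inr Lft # map emb u = a @ s" "map emb v @ [Inr Rgt] = t @ b"
proof -
  have eq: "(Inr Lft # map emb u) @ Inr q # (map emb v @ [Inr Rgt]) = a @ s @ Inr q' # t @ b"
    using assms(1) by (simp add: conf_def)
  have ni: "Inr p \<notin> set (Inr Lft # map emb u)" "Inr p \<notin> set (map emb v @ [Inr Rgt])"
    if "is_ctl p" for p
    using is_ctl_notin_emb[OF that] that by auto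
  show "q' = q" "Inr Lft # map emb u = a @ s" "map emb v @ [Inr Rgt] = t @ b"
    using unique_split[OF eq ni[OF assms(2)]] ni[OF assms(3)] by blast+
qed

lemma conf_left_emb:
  assumes "Inr Lft # map emb u = a @ [emb c]"
  shows "\<exists>u'. u = u' @ [c] \<and> a = Inr Lft # map emb u'"
  using assms by (cases u rule: rev_cases) (auto simp: emb_eq_Inr dest: sym)

lemma conf_right_emb:
  assumes "map emb v @ [Inr Rgt] = emb c # b"
  shows "\<exists>v'. v = c # v' \<and> b = map emb v' @ [Inr Rgt]"
  using assms by (cases v) (auto simp: emb_eq_Inr dest: sym)

lemma conf_right_embs:
  assumes "map emb v @ [Inr Rgt] = map emb w @ b"
  shows "\<exists>v'. v = w @ v' \<and> b = map emb v' @ [Inr Rgt]"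
  using assms
proof (induction w arbitrary: v)
  case (Cons c w)
  then show ?case using conf_right_emb[of v c "map emb w @ b"] by fastforce
qed simp

context
  fixes G :: "'t scm_grammar"
  assumes G: "scm_grammar G"
    and degree: "\<And>r. r \<in> gM G \<Longrightarrow> cond_len (mF r) \<le> 1"
begin

abbreviation "reach \<equiv> (scm_step G)\<^sup>*\<^sup>* [Nt (gS G)]"

section \<open>Soundness of the simulation\<close>

lemma scm_step_iff:
  "scm_step G x y \<longleftrightarrow>
    (\<exists>r\<in>gM G. factor (required r) x \<and> set x \<inter> forbidden r = {} \<and> apply_rules (mrules r) x y)"
proof -
  have "matrix_step r x y \<longleftrightarrow>
    factor (required r) x \<and> set x \<inter> forbidden r = {} \<and> apply_rules (mrules r) x y"
    if "r \<in> gM G" for r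
    using matrix_step_iff[OF degree[OF that]] G that
    by (auto simp: scm_grammar_def wf_matrix_def)
  then show ?thesis unfolding scm_step_def by blast
qed

text \<open>For \<open>App rs\<close> the form \<open>u @ v\<close> is an intermediate word inside a
  matrix and may be unreachable, so the invariant speaks of the words it can still become. The other
  states record the conditions verified so far; for \<open>Swp\<close> the swept part is
  \<open>u\<close>.\<close>

fun ctl_inv :: "'t ctl \<Rightarrow> 't sym list \<Rightarrow> 't sym list \<Rightarrow> bool" where
  "ctl_inv (App rs) u v \<longleftrightarrow> (\<forall>z. apply_rules rs (u @ v) z \<longrightarrow> reach z)"
| "ctl_inv (Pos r) u v \<longleftrightarrow> r \<in> gM G \<and> reach (u @ v)"
| "ctl_inv (Neg r) u v \<longleftrightarrow> r \<in> gM G \<and> reach (u @ v) \<and> factor (required r) (u @ v)"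
| "ctl_inv (Swp r) u v \<longleftrightarrow> r \<in> gM G \<and> reach (u @ v) \<and> factor (required r) (u @ v)
     \<and> set u \<inter> forbidden r = {}"
| "ctl_inv _ _ _ \<longleftrightarrow> False"

lemma ctl_inv_is_ctl: "ctl_inv q u v \<Longrightarrow> is_ctl q"
  by (cases q) auto

lemma ctl_inv_move: "q \<in> movers G \<Longrightarrow> ctl_inv q u v \<Longrightarrow> u @ v = u' @ v' \<Longrightarrow> ctl_inv q u' v'"
  by (auto simp: movers_def)

text \<open>In \<open>fin\<close> the letters \<open>v\<close> to the right of \<open>Fin\<close>
  are already known to be terminal, and \<open>u\<close> is still to be inspected.\<close>

inductive sim_inv :: "('t + 't ctl) list \<Rightarrow> bool" where
  ini: "sim_inv [Inr Ini]"
| conf: "ctl_inv q u v \<Longrightarrow> sim_inv (conf u q v)"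
| fin: "reach (u @ map Tm v) \<Longrightarrow> sim_inv (Inr Lft # map emb u @ Inr Fin # map Inl v)"
| halted: "reach (map Tm v) \<Longrightarrow> sim_inv (map Inl v)"

lemma sim_inv_conf_step:
  assumes inv: "ctl_inv q u v" and "conf u q v = a @ \<alpha> @ b" "(\<alpha>, \<beta>) \<in> sim_rules G"
  shows "sim_inv (a @ \<beta> @ b)"
proof -
  have q: "is_ctl q" using inv by (rule ctl_inv_is_ctl)
  note eq = assms(2)
  \<comment> \<open>Each left side has exactly one symbol satisfying \<open>is_ctl\<close>, and it
    must be \<open>q\<close>; this fixes the position of the redex in every case below.\<close>
  have split: "q' = q \<and> Inr Lft # map emb u = a @ s \<and> map emb v @ [Inr Rgt] = t @ b"
    if "\<alpha> = s @ Inr q' # t" "is_ctl q'" for s q' t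
    using conf_split[of u q v a s q' t b] eq that q by simp
  show ?thesis using assms(3)
  proof cases
    case start
    then have "Ini = q" using split[of "[]" Ini "[]"] by simp
    then show ?thesis using inv by auto
  next
    case (move_right q' c)
    then have *: "q' = q" "a = Inr Lft # map emb u" "map emb v @ [Inr Rgt] = emb c # b"
      using split[of "[]" q' "[emb c]"] movers_is_ctl by auto
    then obtain v' where v': "v = c # v'" "b = map emb v' @ [Inr Rgt]"
      using conf_right_emb by blast
    then have "a @ \<beta> @ b = conf (u @ [c]) q v'" using * move_right by (simp add: conf_def)
    then show ?thesis using ctl_inv_move[OF _ inv, of "u @ [c]" v'] v' move_right *
      by (auto intro: sim_inv.conf)
  next
    case (move_left q' c)
    then have *: "q' = q" "Inr Lft # map emb u = a @ [emb c]" "map emb v @ [Inr Rgt] = b"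
      using split[of "[emb c]" q' "[]"] movers_is_ctl by auto
    then obtain u' where u': "u = u' @ [c]" "a = Inr Lft # map emb u'"
      using conf_left_emb by blast
    then have "a @ \<beta> @ b = conf u' q (c # v)" using * move_left by (simp add: conf_def)
    then show ?thesis using ctl_inv_move[OF _ inv, of u' "c # v"] u' move_left *
      by (auto intro: sim_inv.conf)
  next
    case (select r)
    then have *: "q = App []" "a = Inr Lft # map emb u" "map emb v @ [Inr Rgt] = b"
      using split[of "[]" "App []" "[]"] by auto
    then have "a @ \<beta> @ b = conf u (Pos r) v" using select by (simp add: conf_def)
    then show ?thesis using inv * select by (auto intro!: sim_inv.conf)
  next
    case (check_pos r)
    then have *: "q = Pos r" "a = Inr Lft # map emb u"
      "map emb v @ [Inr Rgt] = map emb (required r) @ b"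
      using split[of "[]" "Pos r" "map emb (required r)"] by auto
    then obtain v' where v': "v = required r @ v'" "b = map emb v' @ [Inr Rgt]"
      using conf_right_embs by blast
    then have "a @ \<beta> @ b = conf u (Neg r) v" using * check_pos by (simp add: conf_def)
    moreover have "factor (required r) (u @ v)" using v' by (auto simp: factor_def)
    ultimately show ?thesis using inv * by (auto intro!: sim_inv.conf)
  next
    case (sweep_start r)
    then have *: "q = Neg r" "Inr Lft # map emb u = a @ [Inr Lft]" "map emb v @ [Inr Rgt] = b"
      using split[of "[Inr Lft]" "Neg r" "[]"] by auto
    then have "u = []" "a = []"
      by (cases u rule: rev_cases; auto simp: emb_eq_Inr dest: sym)+
    then have "a @ \<beta> @ b = conf u (Swp r) v" using sweep_start * by (simp add: conf_def)
    then show ?thesis using inv * \<open>u = []\<close> by (auto intro!: sim_inv.conf)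
  next
    case (sweep r c)
    then have *: "q = Swp r" "a = Inr Lft # map emb u" "map emb v @ [Inr Rgt] = emb c # b"
      using split[of "[]" "Swp r" "[emb c]"] by auto
    then obtain v' where v': "v = c # v'" "b = map emb v' @ [Inr Rgt]"
      using conf_right_emb by blast
    then have "a @ \<beta> @ b = conf (u @ [c]) q v'" using * sweep by (simp add: conf_def)
    moreover have "ctl_inv q (u @ [c]) v'" using inv * v' sweep by auto
    ultimately show ?thesis by (auto intro: sim_inv.conf)
  next
    case (sweep_end r)
    then have *: "q = Swp r" "a = Inr Lft # map emb u" "map emb v @ [Inr Rgt] = Inr Rgt # b"
      using split[of "[]" "Swp r" "[Inr Rgt]"] by auto
    then have v: "v = []" "b = []"
      by (cases v; auto simp: emb_eq_Inr dest: sym)+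
    then have "a @ \<beta> @ b = conf u (App (mrules r)) v" using sweep_end * by (simp add: conf_def)
    \<comment> \<open>At the right end the swept part is the whole form, so all conditions of
      \<open>r\<close> hold and applying all its rules is a step of \<open>G\<close>.\<close>
    moreover have "reach z" if "apply_rules (mrules r) (u @ v) z" for z
    proof -
      have "scm_step G (u @ v) z" using inv * v that by (auto simp: scm_step_iff)
      moreover have "reach (u @ v)" using inv * by simp
      ultimately show ?thesis by (meson rtranclp.rtrancl_into_rtrancl)
    qed
    ultimately show ?thesis by (auto intro!: sim_inv.conf)
  next
    case (app A w rs)
    then have *: "q = App ((A, w) # rs)" "a = Inr Lft # map emb u"
      "map emb v @ [Inr Rgt] = emb (Nt A) # b"
      using split[of "[]" "App ((A, w) # rs)" "[Inr (Orig A)]"] by auto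
    then obtain v' where v': "v = Nt A # v'" "b = map emb v' @ [Inr Rgt]"
      using conf_right_emb by blast
    then have "a @ \<beta> @ b = conf u (App rs) (w @ v')" using * app by (simp add: conf_def)
    moreover have "reach z" if "apply_rules rs (u @ w @ v') z" for z
    proof -
      have "apply_rules ((A, w) # rs) (u @ v) z" using that v' by auto
      then show ?thesis using inv * by simp
    qed
    ultimately show ?thesis by (auto intro!: sim_inv.conf)
  next
    case stop
    then have *: "q = App []" "a = Inr Lft # map emb u" "map emb v @ [Inr Rgt] = Inr Rgt # b"
      using split[of "[]" "App []" "[Inr Rgt]"] by auto
    then have v: "v = []" "b = []"
      by (cases v; auto simp: emb_eq_Inr dest: sym)+
    then show ?thesis using sim_inv.fin[of u "[]"] inv * stop by simp
  next
    case (stop_sweep c)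
    then have "Fin = q" using split[of "[Inl c]" Fin "[]"] by simp
    then show ?thesis using inv by auto
  next
    case stop_end
    then have "Fin = q" using split[of "[Inr Lft]" Fin "[]"] by simp
    then show ?thesis using inv by auto
  qed
qed

text \<open>Under \<open>sim_inv\<close>, words not of the form \<open>conf\<close> can contain only
  \<open>Ini\<close> or \<open>Fin\<close> as control symbol; for these two the applicable rules are
  spelled out.\<close>

lemma sim_rules_ctl:
  assumes "(\<alpha>, \<beta>) \<in> sim_rules G"
  shows "\<exists>s q t. \<alpha> = s @ Inr q # t \<and> is_ctl q \<and>
    (q = Fin \<longrightarrow> t = [] \<and> ((\<exists>c. s = [Inl c] \<and> \<beta> = [Inr Fin, Inl c]) \<or> s = [Inr Lft] \<and> \<beta> = [])) \<and>
    (q = Ini \<longrightarrow> s = [] \<and> t = [] \<and> \<beta> = [Inr Lft, Inr (App []), Inr (Orig (gS G)), Inr Rgt])"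
  using assms
proof cases
  case (move_right q c)
  then have "is_ctl q" "q \<noteq> Fin" "q \<noteq> Ini" using movers_is_ctl by (auto simp: movers_def)
  then show ?thesis using move_right by (metis append_Nil)
next
  case (move_left q c)
  then have "is_ctl q" "q \<noteq> Fin" "q \<noteq> Ini" using movers_is_ctl by (auto simp: movers_def)
  then show ?thesis using move_left by (metis append_Cons append_Nil)
next
  case (sweep_start r)
  then show ?thesis by (intro exI[of _ "[Inr Lft]"] exI[of _ "Neg r"] exI[of _ "[]"]) simp
next
  case (stop_sweep c)
  then show ?thesis by (intro exI[of _ "[Inl c]"] exI[of _ "Fin"] exI[of _ "[]"]) simp
next
  case stop_end
  then show ?thesis by (intro exI[of _ "[Inr Lft]"] exI[of _ "Fin"] exI[of _ "[]"]) simp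
qed (auto intro: exI[of _ "[]"])

lemma sim_inv_step:
  assumes "sim_inv x" "rw (sim_rules G) x y"
  shows "sim_inv y"
proof -
  obtain \<alpha> \<beta> a b where r: "(\<alpha>, \<beta>) \<in> sim_rules G" "x = a @ \<alpha> @ b" "y = a @ \<beta> @ b"
    using assms(2) unfolding rw_def by blast
  obtain s q t where q: "\<alpha> = s @ Inr q # t" "is_ctl q"
    and qF: "q = Fin \<Longrightarrow> t = [] \<and> ((\<exists>c. s = [Inl c] \<and> \<beta> = [Inr Fin, Inl c]) \<or> s = [Inr Lft] \<and> \<beta> = [])"
    and qI: "q = Ini \<Longrightarrow> s = [] \<and> t = [] \<and> \<beta> = [Inr Lft, Inr (App []), Inr (Orig (gS G)), Inr Rgt]"
    using sim_rules_ctl[OF r(1)] by blast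
  show ?thesis using assms(1)
  proof cases
    case ini
    then have "a = []" "b = []" "q = Ini" "s = []" "t = []" using r(2) q
      by (auto simp: append_eq_Cons_conv Cons_eq_append_conv)
    then have "y = conf [] (App []) [Nt (gS G)]" using r(3) qI by (simp add: conf_def)
    then show ?thesis by (auto intro!: sim_inv.conf)
  next
    case (conf q u v)
    then show ?thesis using sim_inv_conf_step r by metis
  next
    case (fin u v)
    have eq: "(Inr Lft # map emb u) @ Inr Fin # map Inl v = a @ s @ Inr q # t @ b"
      using fin(1) r(2) q(1) by simp
    have ni: "Inr p \<notin> set (Inr Lft # map emb u)" "Inr p \<notin> set (map Inl v)" if "is_ctl p" for p
      using is_ctl_notin_emb[OF that] that by auto
    have "Inr q = Inr Fin" "Inr Lft # map emb u = a @ s" "map Inl v = t @ b"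
      using unique_split[OF eq ni[OF is_ctl_simps(5)]] ni[OF q(2)] by blast+
    then have *: "q = Fin" "Inr Lft # map emb u = a @ s" "map Inl v = t @ b" by simp_all
    from qF[OF *(1)] consider c where "t = []" "s = [Inl c]" "\<beta> = [Inr Fin, Inl c]"
      | "t = []" "s = [Inr Lft]" "\<beta> = []" by blast
    then show ?thesis
    proof cases
      case (1 c)
      then obtain u' where "u = u' @ [Tm c]" "a = Inr Lft # map emb u'"
        using *(2) conf_left_emb[of u a "Tm c"] by auto
      then show ?thesis using sim_inv.fin[of u' "c # v"] fin(2) 1 *(3) r(3) by simp
    next
      case 2
      then have "u = []" "a = []" using *(2)
        by (cases u rule: rev_cases; auto simp: emb_eq_Inr dest: sym)+
      then show ?thesis using sim_inv.halted[of v] fin(2) 2 *(3) r(3) by simp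
    qed
  next
    case (halted v)
    then have "set (a @ s @ Inr q # t @ b) = Inl ` set v" using r(2) q(1) by simp
    then have "Inr q \<in> Inl ` set v" by auto
    then show ?thesis by auto
  qed
qed

lemma sim_sound:
  assumes "(rw (sim_rules G))\<^sup>*\<^sup>* [Inr Ini] (map Inl w)"
  shows "reach (map Tm w)"
proof -
  have "sim_inv y" if "(rw (sim_rules G))\<^sup>*\<^sup>* [Inr Ini] y" for y
    using that by induction (auto intro: sim_inv.ini sim_inv_step)
  then have "sim_inv (map Inl w)" using assms by blast
  then show ?thesis
  proof cases
    case (halted v)
    then show ?thesis by (metis inj_Inl inj_map_eq_map)
  qed (auto simp: conf_def map_eq_Cons_conv Cons_eq_map_conv)
qed

section \<open>Completeness of the simulation\<close>

abbreviation "sims \<equiv> (rw (sim_rules G))\<^sup>*\<^sup>*"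

lemma sim_rule: "(\<alpha>, \<beta>) \<in> sim_rules G \<Longrightarrow> x = u @ \<alpha> @ v \<Longrightarrow> y = u @ \<beta> @ v \<Longrightarrow> sims x y"
  by (auto intro: rwI)

lemma sim_move_right:
  assumes q: "q \<in> movers G" and "set w \<subseteq> gV G"
  shows "sims (conf u q (w @ v)) (conf (u @ w) q v)"
  using assms(2)
proof (induction w arbitrary: u)
  case (Cons c w)
  have "sims (conf u q ((c # w) @ v)) (conf (u @ [c]) q (w @ v))"
    by (rule sim_rule[OF sim_rules.move_right[OF q, of c], of _ "Inr Lft # map emb u"
        "map emb (w @ v) @ [Inr Rgt]"]) (use Cons.prems in \<open>auto simp: conf_def\<close>)
  also have "sims \<dots> (conf ((u @ [c]) @ w) q v)"
    using Cons.IH[of "u @ [c]"] Cons.prems by auto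
  finally show ?case by simp
qed simp

lemma sim_move_left:
  assumes q: "q \<in> movers G" and "set w \<subseteq> gV G"
  shows "sims (conf (u @ w) q v) (conf u q (w @ v))"
  using assms(2)
proof (induction w arbitrary: v rule: rev_induct)
  case (snoc c w)
  have "sims (conf (u @ w @ [c]) q v) (conf (u @ w) q (c # v))"
    by (rule sim_rule[OF sim_rules.move_left[OF q, of c], of _ "Inr Lft # map emb (u @ w)"
        "map emb v @ [Inr Rgt]"]) (use snoc.prems in \<open>auto simp: conf_def\<close>)
  also have "sims \<dots> (conf u q (w @ c # v))" using snoc by auto
  finally show ?case by simp
qed simp

lemma sim_move:
  assumes "q \<in> movers G" "set (u @ v) \<subseteq> gV G" "u @ v = u' @ v'"
  shows "sims (conf u q v) (conf u' q v')"
proof -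
  have "sims (conf u q v) (conf [] q (u @ v))"
    using sim_move_left[OF assms(1), of u "[]" v] assms(2) by simp
  also have "sims \<dots> (conf u' q v')"
    using sim_move_right[OF assms(1), of u' "[]" v'] assms(2,3) by simp
  finally show ?thesis .
qed

lemma sim_sweep:
  assumes "r \<in> gM G" "set w \<subseteq> gV G" "set w \<inter> forbidden r = {}"
  shows "sims (conf u (Swp r) w) (conf (u @ w) (Swp r) [])"
  using assms(2,3)
proof (induction w arbitrary: u)
  case (Cons c w)
  have "sims (conf u (Swp r) (c # w)) (conf (u @ [c]) (Swp r) w)"
    by (rule sim_rule[OF sim_rules.sweep[OF assms(1), of c], of _ "Inr Lft # map emb u"
        "map emb w @ [Inr Rgt]"]) (use Cons.prems in \<open>auto simp: conf_def\<close>)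
  also have "sims \<dots> (conf ((u @ [c]) @ w) (Swp r) [])" using Cons.IH[of "u @ [c]"] Cons.prems by auto
  finally show ?case by simp
qed simp

lemma sim_apply:
  assumes "apply_rules rs (u @ v) y" "rs \<in> rule_suffixes G" "set (u @ v) \<subseteq> gV G"
  shows "sims (conf u (App rs) v) (conf [] (App []) y)"
  using assms
proof (induction rs arbitrary: u v)
  case Nil
  then show ?case by (auto intro!: sim_move simp: movers_def)
next
  case (Cons p rs)
  obtain A w where p: "p = (A, w)" by (cases p)
  from Cons.prems(1) p obtain u' v' where *: "u @ v = u' @ [Nt A] @ v'" "apply_rules rs (u' @ w @ v') y"
    by auto
  have w: "set w \<subseteq> gV G"
    using rule_suffixes_set[OF Cons.prems(2), of p] scm_grammar_ruleD(2)[OF G] p by auto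
  have "sims (conf u (App (p # rs)) v) (conf u' (App (p # rs)) (Nt A # v'))"
    by (rule sim_move) (use Cons.prems * in \<open>auto simp: movers_def\<close>)
  also have "sims \<dots> (conf u' (App rs) (w @ v'))"
    by (rule sim_rule[OF sim_rules.app[OF Cons.prems(2)[unfolded p]],
        of _ "Inr Lft # map emb u'" "map emb v' @ [Inr Rgt]"]) (auto simp: conf_def p)
  also have "sims \<dots> (conf [] (App []) y)"
  proof (rule Cons.IH)
    have "set (u' @ [Nt A] @ v') \<subseteq> gV G" using Cons.prems(3) unfolding *(1) .
    then show "set (u' @ w @ v') \<subseteq> gV G" using w by auto
  qed (use * rule_suffixes_tl[OF Cons.prems(2)] in auto)
  finally show ?case .
qed

lemma sim_step:
  assumes "scm_step G x y" and x: "set x \<subseteq> gV G"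
  shows "sims (conf [] (App []) x) (conf [] (App []) y)"
proof -
  obtain r where r: "r \<in> gM G" "factor (required r) x" "set x \<inter> forbidden r = {}"
    "apply_rules (mrules r) x y" using assms(1) unfolding scm_step_iff by blast
  obtain u v where uv: "x = u @ required r @ v" using r(2) unfolding factor_def by blast
  have mv: "Pos r \<in> movers G" "Neg r \<in> movers G" using r(1) by (auto simp: movers_def)
  have "sims (conf [] (App []) x) (conf [] (Pos r) x)"
    by (rule sim_rule[OF sim_rules.select[OF r(1)], of _ "[Inr Lft]" "map emb x @ [Inr Rgt]"])
      (auto simp: conf_def)
  also have "sims \<dots> (conf u (Pos r) (required r @ v))"
    by (rule sim_move[OF mv(1)]) (use x uv in auto)
  also have "sims \<dots> (conf u (Neg r) (required r @ v))"
    by (rule sim_rule[OF sim_rules.check_pos[OF r(1)], of _ "Inr Lft # map emb u"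
        "map emb v @ [Inr Rgt]"]) (auto simp: conf_def)
  also have "sims \<dots> (conf [] (Neg r) x)"
    by (rule sim_move[OF mv(2)]) (use x uv in auto)
  also have "sims \<dots> (conf [] (Swp r) x)"
    by (rule sim_rule[OF sim_rules.sweep_start[OF r(1)], of _ "[]" "map emb x @ [Inr Rgt]"])
      (auto simp: conf_def)
  also have "sims \<dots> (conf x (Swp r) [])"
    using sim_sweep[OF r(1) x r(3), of "[]"] by simp
  also have "sims \<dots> (conf x (App (mrules r)) [])"
    by (rule sim_rule[OF sim_rules.sweep_end[OF r(1)], of _ "Inr Lft # map emb x" "[]"])
      (auto simp: conf_def)
  also have "sims \<dots> (conf [] (App []) y)"
    by (rule sim_apply) (use r x mrules_suffix in auto)
  finally show ?thesis .
qed

lemma sim_halt: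
  assumes "set (map Tm w) \<subseteq> gV G"
  shows "sims (conf [] (App []) (map Tm w)) (map Inl w)"
proof -
  have "sims (conf [] (App []) (map Tm w)) (conf (map Tm w) (App []) [])"
    by (rule sim_move) (use assms in \<open>auto simp: movers_def rule_suffixes_def\<close>)
  also have "sims \<dots> (Inr Lft # map emb (map Tm w) @ Inr Fin # map Inl [])"
    by (rule sim_rule[OF sim_rules.stop, of _ "Inr Lft # map emb (map Tm w)" "[]"])
      (auto simp: conf_def)
  also have "sims (Inr Lft # map emb (map Tm w) @ Inr Fin # map Inl v)
      ([Inr Lft, Inr Fin] @ map Inl (w @ v))" for v
    using assms
  proof (induction w arbitrary: v rule: rev_induct)
    case (snoc a w)
    have "sims (Inr Lft # map emb (map Tm (w @ [a])) @ Inr Fin # map Inl v)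
        (Inr Lft # map emb (map Tm w) @ Inr Fin # map Inl (a # v))"
      by (rule sim_rule[OF sim_rules.stop_sweep[of a], of _ "Inr Lft # map emb (map Tm w)" "map Inl v"])
        (use snoc.prems in auto)
    also have "sims \<dots> ([Inr Lft, Inr Fin] @ map Inl (w @ a # v))"
      using snoc.IH[of "a # v"] snoc.prems by auto
    finally show ?case by simp
  qed simp
  also have "sims ([Inr Lft, Inr Fin] @ map Inl (w @ [])) (map Inl w)"
    by (rule sim_rule[OF sim_rules.stop_end, of _ "[]" "map Inl w"]) auto
  finally show ?thesis .
qed

lemma sim_complete:
  assumes "reach (map Tm w)"
  shows "sims [Inr Ini] (map Inl w)"
proof -
  have "sims [Inr Ini] (conf [] (App []) x)" if "reach x" for x
    using that
  proof induction
    case base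
    show ?case
      by (rule sim_rule[OF sim_rules.start, of _ "[]" "[]"]) (auto simp: conf_def)
  next
    case (step y z)
    note step(3)
    also have "sims (conf [] (App []) y) (conf [] (App []) z)"
      using sim_step[OF step(2)] scm_reachable_alphabet[OF G step(1)] .
    finally show ?case .
  qed
  from this[OF assms] sim_halt[OF scm_reachable_alphabet[OF G assms]] show ?thesis by simp
qed

lemma scm_lang_in_RE: "scm_lang G \<in> RE"
proof -
  have "{w. sims [Inr Ini] (map Inl w)} \<in> RE"
    by (rule rewriting_lang_in_RE[OF finite_sim_rules[OF G] finite_sim_alphabet[OF G]])
      (use sim_rules_alphabet[OF G] in \<open>auto simp: sim_alphabet_def\<close>)
  moreover have "reach (map Tm w) \<longleftrightarrow> sims [Inr Ini] (map Inl w)" for w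
    using sim_sound sim_complete by blast
  ultimately show ?thesis unfolding scm_lang_def by simp
qed

end

lemma SSCM_subset_RE: "(SSCM i (Some 1) n m l :: 't list set set) \<subseteq> RE"
proof
  fix L :: "'t list set" assume "L \<in> SSCM i (Some 1) n m l"
  then obtain G :: "'t scm_grammar" where "scm_grammar G" "\<forall>r\<in>gM G. bnd (Some 1) (cond_len (mF r))"
    "scm_lang G = L"
    unfolding SSCM_def SCM_def by blast
  then show "L \<in> RE" using scm_lang_in_RE[of G] by (simp add: bnd_def)
qed

section \<open>Derivations as runs of a queue\<close>

text \<open>A triple of the word pushed at the back, the word popped at the front, and the output
  emitted.\<close>

type_synonym ('s, 't) queue_op = "'s list \<times> 's list \<times> 't list"

definition pushes :: "('s, 't) queue_op list \<Rightarrow> 's list" where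
  "pushes os = concat (map fst os)"

definition pops :: "('s, 't) queue_op list \<Rightarrow> 's list" where
  "pops os = concat (map (\<lambda>p. fst (snd p)) os)"

definition emits :: "('s, 't) queue_op list \<Rightarrow> 't list" where
  "emits os = concat (map (\<lambda>p. snd (snd p)) os)"

lemma queue_simps [simp]:
  "pushes [] = []" "pops [] = []" "emits [] = []"
  "pushes ((u, v, e) # os) = u @ pushes os"
  "pops ((u, v, e) # os) = v @ pops os"
  "emits ((u, v, e) # os) = e @ emits os"
  "pushes (os @ os') = pushes os @ pushes os'"
  "pops (os @ os') = pops os @ pops os'"
  "emits (os @ os') = emits os @ emits os'"
  by (simp_all add: pushes_def pops_def emits_def)

text \<open>The separator \<open>None\<close> marks the end of the sentential form: the queue \<open>y # z\<close> represents the
  form \<open>z y\<close>. A terminal is emitted only when it directly follows the separator, that is, when it is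
  the first letter of the form.\<close>

definition ps_ops :: "'t ps_grammar \<Rightarrow> ('t sym option, 't) queue_op set" where
  "ps_ops G = (\<lambda>c. ([c], [c], [])) ` insert None (Some ` pV G)
     \<union> (\<lambda>(\<alpha>, \<beta>). (map Some \<beta>, map Some \<alpha>, [])) ` pR G
     \<union> (\<lambda>a. ([None], [None, Some (Tm a)], [a])) ` {a. Tm a \<in> pV G}"

lemma map_Some_prefix:
  assumes "map Some \<alpha> @ xs = map Some y @ None # ys"
  shows "\<exists>y'. y = \<alpha> @ y' \<and> xs = map Some y' @ None # ys"
  using assms
proof (induction \<alpha> arbitrary: y)
  case (Cons a \<alpha>)
  then show ?case by (cases y) auto
qed simp

lemma ps_stepI: "(\<alpha>, \<beta>) \<in> pR G \<Longrightarrow> ps_step G (u @ \<alpha> @ v) (u @ \<beta> @ v)"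
  unfolding ps_step_def by blast

text \<open>The equation does not demand that every pop happens after the corresponding push. This is
  automatic: a word without separator cannot reach beyond the separator in the queue, and popping
  separator and terminal from a queue that consists of the separator only would have to match a
  separator with the terminal.\<close>

lemma queue_sound:
  assumes "map Some y @ None # map Some z @ pushes os = pops os @ [None]"
    and "(ps_step G)\<^sup>*\<^sup>* s (map Tm w @ z @ y)" and "set os \<subseteq> ps_ops G"
  shows "(ps_step G)\<^sup>*\<^sup>* s (map Tm (w @ emits os))"
  using assms
\<comment> \<open>Here \<open>w\<close> is the output so far, \<open>y\<close> the part of the form
  before the separator in the queue, and \<open>z\<close> the part behind it, already moved in the
  current round.\<close>
proof (induction os arbitrary: y z w)
  case Nil
  then show ?case by (cases y) auto
next
  case (Cons p os)
  from Cons.prems(3) have os: "set os \<subseteq> ps_ops G" and "p \<in> ps_ops G" by auto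
  from \<open>p \<in> ps_ops G\<close> consider (sep) "p = ([None], [None], [])"
    | (copy) c where "p = ([Some c], [Some c], [])"
    | (rule) \<alpha> \<beta> where "(\<alpha>, \<beta>) \<in> pR G" "p = (map Some \<beta>, map Some \<alpha>, [])"
    | (emit) a where "p = ([None], [None, Some (Tm a)], [a])"
    by (auto simp: ps_ops_def)
  then show ?case
  proof cases
    case sep
    with Cons.prems(1) have "y = []" by (cases y) auto
    then show ?thesis using Cons.IH[of z "[]" w] Cons.prems os sep by simp
  next
    case (copy c)
    with Cons.prems(1) obtain y' where "y = c # y'" by (cases y) auto
    then show ?thesis using Cons.IH[of y' "z @ [c]" w] Cons.prems os copy by simp
  next
    case (rule \<alpha> \<beta>)
    have "map Some \<alpha> @ (pops os @ [None]) = map Some y @ None # (map Some z @ map Some \<beta> @ pushes os)"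
      using Cons.prems(1) rule by simp
    from map_Some_prefix[OF this] obtain y' where y': "y = \<alpha> @ y'"
      "pops os @ [None] = map Some y' @ None # map Some z @ map Some \<beta> @ pushes os" by blast
    have "ps_step G (map Tm w @ z @ y) (map Tm w @ (z @ \<beta>) @ y')"
      using ps_stepI[OF rule(1), of "map Tm w @ z" y'] y' by simp
    with Cons.prems(2) have "(ps_step G)\<^sup>*\<^sup>* s (map Tm w @ (z @ \<beta>) @ y')" by simp
    then show ?thesis using Cons.IH[of y' "z @ \<beta>" w] y' os rule by simp
  next
    case (emit a)
    with Cons.prems(1) have "y = []" by (cases y) auto
    moreover from this Cons.prems(1) emit obtain z' where "z = Tm a # z'" by (cases z) auto
    ultimately show ?thesis using Cons.IH[of z' "[]" "w @ [a]"] Cons.prems os emit by simp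
  qed
qed

section \<open>From derivations to queue runs\<close>

lemma queue_copy:
  fixes G :: "'t ps_grammar"
  assumes "set xs \<subseteq> insert None (Some ` pV G)"
  shows "\<exists>os. set os \<subseteq> ps_ops G \<and> pushes os = xs \<and> pops os = xs \<and> emits os = []"
  using assms
proof (induction xs)
  case Nil
  then show ?case by (intro exI[of _ "[]"]) simp
next
  case (Cons x xs)
  then obtain os where "set os \<subseteq> ps_ops G" "pushes os = xs" "pops os = xs" "emits os = []" by auto
  moreover have "([x], [x], []) \<in> ps_ops G" using Cons.prems by (auto simp: ps_ops_def)
  ultimately show ?case by (intro exI[of _ "([x], [x], []) # os"]) simp
qed

lemma ps_reachable_alphabet:
  assumes G: "ps_grammar G" and "(ps_step G)\<^sup>*\<^sup>* [Nt (pS G)] x"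
  shows "set x \<subseteq> pV G"
  using assms(2)
proof induction
  case base
  then show ?case using G by (simp add: ps_grammar_def)
next
  case (step y z)
  then obtain \<alpha> \<beta> u v where "(\<alpha>, \<beta>) \<in> pR G" "y = u @ \<alpha> @ v" "z = u @ \<beta> @ v"
    by (auto simp: ps_step_def)
  moreover from this have "set \<beta> \<subseteq> pV G" using G by (auto simp: ps_grammar_def)
  ultimately show ?case using step.IH by auto
qed

definition queue_start :: "'t ps_grammar \<Rightarrow> 't sym option list" where
  "queue_start G = [Some (Nt (pS G)), None]"

text \<open>One derivation step is one rotation of the queue: the letters around the rewritten
  factor are copied, the factor is popped and its replacement pushed. What follows
  \<open>pops os\<close> in the equation is the current content of the queue.\<close>

lemma queue_derive:
  assumes G: "ps_grammar G" and "(ps_step G)\<^sup>*\<^sup>* [Nt (pS G)] x"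
  shows "\<exists>os. set os \<subseteq> ps_ops G \<and> emits os = [] \<and>
    queue_start G @ pushes os = pops os @ map Some x @ [None]"
  using assms(2)
proof induction
  case base
  then show ?case by (intro exI[of _ "[]"]) (simp add: queue_start_def)
next
  case (step y z)
  then obtain os where os: "set os \<subseteq> ps_ops G" "emits os = []"
    "queue_start G @ pushes os = pops os @ map Some y @ [None]" by blast
  obtain \<alpha> \<beta> u v where r: "(\<alpha>, \<beta>) \<in> pR G" "y = u @ \<alpha> @ v" "z = u @ \<beta> @ v"
    using step(2) by (auto simp: ps_step_def)
  have "set y \<subseteq> pV G" using ps_reachable_alphabet[OF G step(1)] .
  then have "set (map Some u) \<subseteq> insert None (Some ` pV G)"
    "set (map Some v @ [None]) \<subseteq> insert None (Some ` pV G)" using r by auto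
  then obtain os1 os2 where os1: "set os1 \<subseteq> ps_ops G" "pushes os1 = map Some u"
      "pops os1 = map Some u" "emits os1 = []"
    and os2: "set os2 \<subseteq> ps_ops G" "pushes os2 = map Some v @ [None]"
      "pops os2 = map Some v @ [None]" "emits os2 = []"
    using queue_copy by meson
  have "(map Some \<beta>, map Some \<alpha>, []) \<in> ps_ops G" using r(1) by (force simp: ps_ops_def)
  then show ?case using os os1 os2 r
    by (intro exI[of _ "os @ os1 @ [(map Some \<beta>, map Some \<alpha>, [])] @ os2"]) simp
qed

text \<open>Each letter takes one round: copying the terminal word brings the separator to the front
  with the first letter next to it, and the emitting operation consumes that letter.\<close>

lemma queue_emit:
  assumes "set (map Tm w) \<subseteq> pV G" "set os \<subseteq> ps_ops G"
    "queue_start G @ pushes os = pops os @ map Some (map Tm w) @ [None]"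
  shows "\<exists>os'. set os' \<subseteq> ps_ops G \<and> emits os' = emits os @ w \<and>
    queue_start G @ pushes os' = pops os' @ [None]"
  using assms
proof (induction w arbitrary: os)
  case Nil
  then show ?case by auto
next
  case (Cons a w)
  have "set (map Some (map Tm (a # w))) \<subseteq> insert None (Some ` pV G)" using Cons.prems(1) by auto
  then obtain os1 where os1: "set os1 \<subseteq> ps_ops G" "pushes os1 = map Some (map Tm (a # w))"
      "pops os1 = map Some (map Tm (a # w))" "emits os1 = []"
    using queue_copy by meson
  have e: "([None], [None, Some (Tm a)], [a]) \<in> ps_ops G" using Cons.prems(1) by (auto simp: ps_ops_def)
  let ?os = "os @ os1 @ [([None], [None, Some (Tm a)], [a])]"
  have "\<exists>os'. set os' \<subseteq> ps_ops G \<and> emits os' = emits ?os @ w \<and>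
    queue_start G @ pushes os' = pops os' @ [None]"
    by (rule Cons.IH) (use Cons.prems os1 e in auto)
  then show ?case using os1 by simp
qed

theorem ps_lang_queue:
  assumes G: "ps_grammar G"
  shows "ps_lang G = {emits os |os. set os \<subseteq> ps_ops G \<and> queue_start G @ pushes os = pops os @ [None]}"
    (is "_ = ?Q")
proof (intro set_eqI iffI)
  fix w assume "w \<in> ps_lang G"
  then have d: "(ps_step G)\<^sup>*\<^sup>* [Nt (pS G)] (map Tm w)" by (simp add: ps_lang_def)
  from queue_derive[OF G d] obtain os where "set os \<subseteq> ps_ops G" "emits os = []"
    "queue_start G @ pushes os = pops os @ map Some (map Tm w) @ [None]" by blast
  from queue_emit[OF ps_reachable_alphabet[OF G d] this(1,3)] this(2)
  show "w \<in> ?Q" by auto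
next
  fix w assume "w \<in> ?Q"
  then obtain os where "w = emits os" "set os \<subseteq> ps_ops G"
    "queue_start G @ pushes os = pops os @ [None]" by blast
  then show "w \<in> ps_lang G"
    using queue_sound[of "[Nt (pS G)]" "[]" os G "[Nt (pS G)]" "[]"]
    by (simp add: ps_lang_def queue_start_def)
qed

lemma finite_ps_ops:
  assumes "ps_grammar G"
  shows "finite (ps_ops G)"
proof -
  have "{a. Tm a \<in> pV G} = Tm -` pV G" by auto
  then have "finite {a. Tm a \<in> pV G}"
    using assms finite_vimageI[of "pV G" Tm] by (simp add: ps_grammar_def inj_def)
  then show ?thesis using assms by (simp add: ps_ops_def ps_grammar_def)
qed

section \<open>Binary codes\<close>

text \<open>A prefix code for injective \<open>\<kappa>\<close>. The \<open>Suc\<close> makes every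
  code word begin with \<open>True\<close>, as \<open>framed\<close> demands; all of them end with
  \<open>False\<close>.\<close>

definition code :: "('s \<Rightarrow> nat) \<Rightarrow> 's list \<Rightarrow> bool list" where
  "code \<kappa> xs = concat (map (\<lambda>x. replicate (Suc (\<kappa> x)) True @ [False]) xs)"

lemma code_simps [simp]:
  "code \<kappa> [] = []"
  "code \<kappa> (x # xs) = replicate (Suc (\<kappa> x)) True @ False # code \<kappa> xs"
  "code \<kappa> (xs @ ys) = code \<kappa> xs @ code \<kappa> ys"
  by (simp_all add: code_def)

lemma replicate_True_False_inj:
  "replicate m True @ False # xs = replicate n True @ False # ys \<Longrightarrow> m = n \<and> xs = ys"
proof (induction m arbitrary: n)
  case 0
  then show ?case by (cases n) auto
next
  case (Suc m)
  then show ?case by (cases n) auto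
qed

lemma code_inj:
  assumes "inj_on \<kappa> A" "set xs \<subseteq> A" "set ys \<subseteq> A" "code \<kappa> xs = code \<kappa> ys"
  shows "xs = ys"
  using assms(2-4)
proof (induction xs arbitrary: ys)
  case Nil
  then show ?case by (cases ys) auto
next
  case (Cons x xs)
  then obtain y ys' where y: "ys = y # ys'" by (cases ys) auto
  have "Suc (\<kappa> x) = Suc (\<kappa> y) \<and> code \<kappa> xs = code \<kappa> ys'"
    using Cons.prems(3) y by (intro replicate_True_False_inj) simp
  moreover from this have "x = y" using assms(1) Cons.prems y by (auto dest: inj_onD)
  ultimately show ?case using Cons.IH[of ys'] Cons.prems y by auto
qed

text \<open>The final \<open>False\<close> of the pushed word rules out a block of three marked
  letters next to \<open>S\<^sub>0\<close> in the first phase. The initial \<open>True\<close> of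
  the popped word differs from the extra bit \<open>False\<close> put before the pushed word, so
  these two bits cannot cancel completely against each other.\<close>

definition framed :: "bool list \<Rightarrow> bool" where
  "framed bs \<longleftrightarrow> bs = [] \<or> hd bs \<and> \<not> last bs"

lemma framed_append: "framed bs \<Longrightarrow> framed cs \<Longrightarrow> framed (bs @ cs)"
  by (auto simp: framed_def hd_append last_append)

lemma framed_code: "framed (code \<kappa> xs)"
proof (induction xs)
  case (Cons x xs)
  have "framed (replicate (Suc (\<kappa> x)) True @ [False])" by (simp add: framed_def)
  from framed_append[OF this Cons] show ?case by simp
qed (simp add: framed_def)

section \<open>Cancellation of coded words\<close>

text \<open>The rules below name their left sides by number: 2, 3, 4, 5 are
  \<open>A\<^sub>0\<close>, \<open>B\<^sub>0\<close>, \<open>C\<^sub>0\<close>,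
  \<open>S\<^sub>0\<close>.\<close>

abbreviation "A\<^sub>0 \<equiv> Nt 2"
abbreviation "B\<^sub>0 \<equiv> Nt 3"
abbreviation "C\<^sub>0 \<equiv> Nt 4"
abbreviation "S\<^sub>0 \<equiv> Nt 5"

definition run :: "bool \<Rightarrow> nat" where
  "run b = (if b then 2 else 1)"

definition blk :: "bool \<Rightarrow> 't sym list" where
  "blk b = A\<^sub>0 # replicate (run b) B\<^sub>0"

definition enc :: "bool list \<Rightarrow> 't sym list" where
  "enc bs = concat (map blk bs)"

text \<open>The coding with each \<open>A\<^sub>0\<close> behind its run. It describes the word left
  of the centre, and its mirror image, which is \<open>enc\<close> of the reversed bits, the word
  right of it; so nonempty words have \<open>A\<^sub>0\<close> next to the centre on both
  sides.\<close>

definition enc_shift :: "bool list \<Rightarrow> 't sym list" where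
  "enc_shift bs = concat (map (\<lambda>b. replicate (run b) B\<^sub>0 @ [A\<^sub>0]) bs)"

lemma run_pos [simp]: "0 < run b" "run b \<le> 2" "replicate (run b) x \<noteq> []"
  by (auto simp: run_def)

lemma enc_simps [simp]:
  "enc [] = []" "enc (b # bs) = A\<^sub>0 # replicate (run b) B\<^sub>0 @ enc bs"
  "enc (bs @ cs) = enc bs @ enc cs"
  by (simp_all add: enc_def blk_def)

lemma enc_shift_simps [simp]:
  "enc_shift [] = []" "enc_shift (b # bs) = replicate (run b) B\<^sub>0 @ A\<^sub>0 # enc_shift bs"
  "enc_shift (bs @ cs) = enc_shift bs @ enc_shift cs"
  by (simp_all add: enc_shift_def)

lemma enc_snoc_eq_enc_shift: "enc bs @ [A\<^sub>0] = A\<^sub>0 # enc_shift bs"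
  by (induction bs) auto

lemma enc_rev_eq_enc_shift: "enc (rev bs) = rev (enc_shift bs)"
  by (induction bs) auto

lemma set_enc: "set (enc bs) \<subseteq> {A\<^sub>0, B\<^sub>0}"
  by (induction bs) auto

lemma set_enc_shift: "set (enc_shift bs) \<subseteq> {A\<^sub>0, B\<^sub>0}"
  by (induction bs) auto

text \<open>At a block boundary the last two letters differ, so no two equal letters can be removed
  there on one side alone.\<close>

lemma enc_shift_end: "(enc_shift bs :: 't sym list) = [] \<or> (\<exists>z :: 't sym list. enc_shift bs = z @ [B\<^sub>0, A\<^sub>0])"
proof (cases bs rule: rev_cases)
  case (snoc bs' b)
  then show ?thesis by (cases b) (auto simp: run_def numeral_2_eq_2)
qed simp

lemma enc_shift_rev_start: "rev (enc_shift bs :: 't sym list) = [] \<or> (\<exists>z :: 't sym list. rev (enc_shift bs) = [A\<^sub>0, B\<^sub>0] @ z)"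
proof -
  have "\<exists>z. rev (enc_shift bs :: 't sym list) = [A\<^sub>0, B\<^sub>0] @ z" if "enc_shift bs = z @ [B\<^sub>0, A\<^sub>0]" for z :: "'t sym list"
    using that by (intro exI[of _ "rev z"]) simp
  then show ?thesis using enc_shift_end[where ?'t = 't, of bs] by (metis rev.simps(1))
qed

lemma count_list_replicate: "count_list (replicate n x) y = (if x = y then n else 0)"
  by (induction n) auto

lemma count_enc_shift:
  "count_list (enc_shift bs :: 't sym list) A\<^sub>0 = length bs"
  "length bs \<le> count_list (enc_shift bs :: 't sym list) B\<^sub>0"
  by (induction bs) (auto simp: run_def numeral_2_eq_2)

text \<open>The grammar can remove two equal letters that form a contiguous block with the centre; it cannot
  tell whether they lie on the same side of it.\<close>

definition cancel :: "'t sym list \<Rightarrow> 't sym list \<Rightarrow> 't sym list \<Rightarrow> 't sym list \<Rightarrow> bool" where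
  "cancel L R L' R' \<longleftrightarrow> (\<exists>X.
     L = L' @ [X, X] \<and> R' = R \<or> L = L' @ [X] \<and> R = X # R' \<or> L' = L \<and> R = [X, X] @ R')"

text \<open>Cancelling on one side only is harmless: in a run of \<open>B\<^sub>0\<close>s it preserves the parity of the total
  length, and runs have length 1 or 2.\<close>

inductive partial :: "bool list \<Rightarrow> bool list \<Rightarrow> 't sym list \<Rightarrow> 't sym list \<Rightarrow> bool" for bs\<^sub>0 cs\<^sub>0 where
  aligned: "bs\<^sub>0 = bs @ ds \<Longrightarrow> cs\<^sub>0 = cs @ ds \<Longrightarrow> partial bs\<^sub>0 cs\<^sub>0 (enc_shift bs) (rev (enc_shift cs))"
| inside: "bs\<^sub>0 = bs @ p # ds \<Longrightarrow> cs\<^sub>0 = cs @ q # ds \<Longrightarrow> i \<le> 2 \<Longrightarrow> j \<le> 2 \<Longrightarrow> 0 < i + j \<Longrightarrow>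
    odd (i + j) \<longleftrightarrow> p \<noteq> q \<Longrightarrow>
    partial bs\<^sub>0 cs\<^sub>0 (enc_shift bs @ replicate i B\<^sub>0) (replicate j B\<^sub>0 @ rev (enc_shift cs))"

text \<open>If \<open>i + j = 0\<close>, the parity condition gives \<open>p = q\<close>, and the
  two finished blocks join the common suffix \<open>ds\<close>.\<close>

lemma partialI:
  assumes "bs\<^sub>0 = bs @ p # ds" "cs\<^sub>0 = cs @ q # ds" "i \<le> 2" "j \<le> 2" "odd (i + j) \<longleftrightarrow> p \<noteq> q"
  shows "partial bs\<^sub>0 cs\<^sub>0 (enc_shift bs @ replicate i B\<^sub>0) (replicate j B\<^sub>0 @ rev (enc_shift cs))"
proof (cases "i + j = 0")
  case True
  then show ?thesis using assms aligned[of bs\<^sub>0 bs "p # ds" cs\<^sub>0 cs] by simp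
next
  case False
  then show ?thesis using inside[OF assms(1-4) _ assms(5)] by simp
qed

text \<open>At block boundaries only one \<open>A\<^sub>0\<close> on each side can go, which opens
  the last block of both words. Inside the runs every cancellation takes two of the
  \<open>i + j\<close> remaining \<open>B\<^sub>0\<close>, so their parity still tells whether the
  two bits agree.\<close>

lemma partial_cancel:
  fixes L R L' R' :: "'t sym list"
  assumes "partial bs\<^sub>0 cs\<^sub>0 L R" "cancel L R L' R'"
  shows "partial bs\<^sub>0 cs\<^sub>0 L' R'"
  using assms(1)
proof cases
  case (aligned bs ds cs)
  from assms(2) obtain X where X: "L = L' @ [X, X] \<and> R' = R \<or> L = L' @ [X] \<and> R = X # R' \<or> L' = L \<and> R = [X, X] @ R'"
    unfolding cancel_def by blast
  then have mid: "L = L' @ [X]" "R = X # R'"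
    using aligned enc_shift_end[where ?'t = 't, of bs] enc_shift_rev_start[where ?'t = 't, of cs] by auto
  obtain bs' p where bs': "bs = bs' @ [p]" using mid aligned by (cases bs rule: rev_cases) auto
  obtain cs' q where cs': "cs = cs' @ [q]" using mid aligned by (cases cs rule: rev_cases) auto
  have "L' = enc_shift bs' @ replicate (run p) B\<^sub>0" "R' = replicate (run q) B\<^sub>0 @ rev (enc_shift cs')"
    using mid aligned bs' cs' by auto
  moreover have "odd (run p + run q) \<longleftrightarrow> p \<noteq> q" by (auto simp: run_def)
  ultimately show ?thesis using aligned bs' cs' by (auto intro!: partialI)
next
  case (inside bs p ds cs q i j)
  from assms(2) obtain X where
    "L = L' @ [X, X] \<and> R' = R \<or> L = L' @ [X] \<and> R = X # R' \<or> L' = L \<and> R = [X, X] @ R'"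
    unfolding cancel_def by blast
  then consider (left) "L = L' @ [X, X]" "R' = R" | (mid) "L = L' @ [X]" "R = X # R'"
    | (right) "L' = L" "R = [X, X] @ R'" by blast
  then show ?thesis
  proof cases
    case left
    have "i = 0 \<or> i = 1 \<or> i = 2" using inside(5) by linarith
    \<comment> \<open>With fewer than two open \<open>B\<^sub>0\<close>, the last two letters of
      \<open>L\<close>, if there are two, would be \<open>B\<^sub>0 A\<^sub>0\<close> or
      \<open>A\<^sub>0 B\<^sub>0\<close>.\<close>
    then have "i = 2 \<and> L' = enc_shift bs" using left(1) inside(1) enc_shift_end[where ?'t = 't, of bs] by (auto simp: numeral_2_eq_2)
    then show ?thesis using partialI[of bs\<^sub>0 bs p ds cs\<^sub>0 cs q 0 j] inside left by auto
  next
    case mid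
    have snoc: "enc_shift bs @ replicate (Suc k) B\<^sub>0 = (enc_shift bs @ replicate k B\<^sub>0) @ [B\<^sub>0 :: 't sym]" for k
      by (simp add: replicate_append_same)
    have "X = B\<^sub>0" if "0 < i"
      using that mid(1) inside(1) snoc by (metis gr0_implies_Suc last_snoc)
    moreover have "X = B\<^sub>0" if "0 < j" using that mid(2) inside(2) by (cases j) auto
    moreover have "X = A\<^sub>0" if "i = 0"
      using that mid(1) inside(1) enc_shift_end[where ?'t = 't, of bs] by auto
    moreover have "X = A\<^sub>0" if "j = 0"
      using that mid(2) inside(2) enc_shift_rev_start[where ?'t = 't, of cs] by auto
    \<comment> \<open>A side whose run is used up offers only \<open>A\<^sub>0\<close>, the other
      one \<open>B\<^sub>0\<close>; as \<open>0 < i + j\<close>, neither run can be used up.\<close>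
    ultimately have "0 < i" "0 < j" using inside(7) by (cases "i = 0"; cases "j = 0"; auto)+
    then obtain i' j' where ij: "i = Suc i'" "j = Suc j'" by (meson gr0_implies_Suc)
    have "L' @ [X] = (enc_shift bs @ replicate i' B\<^sub>0) @ [B\<^sub>0]" using mid(1) inside(1) ij(1) snoc[of i'] by metis
    then have "L' = enc_shift bs @ replicate i' B\<^sub>0" by simp
    moreover have "R' = replicate j' B\<^sub>0 @ rev (enc_shift cs)" using mid(2) inside(2) ij(2) by auto
    ultimately show ?thesis using partialI[of bs\<^sub>0 bs p ds cs\<^sub>0 cs q i' j'] inside ij by auto
  next
    case right
    have "j = 0 \<or> j = 1 \<or> j = 2" using inside(6) by linarith
    then have "j = 2 \<and> R' = rev (enc_shift cs)" using right(2) inside(2) enc_shift_rev_start[where ?'t = 't, of cs]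
      by (auto simp: numeral_2_eq_2)
    then show ?thesis using partialI[of bs\<^sub>0 bs p ds cs\<^sub>0 cs q i 0] inside right by auto
  qed
qed

text \<open>If nothing were left in the aligned state, the common suffix would begin both with
  \<open>False\<close> and with \<open>True\<close>. The remaining \<open>B\<^sub>0\<close> keeps
  the matrix with the forbidding condition blocked in the second phase.\<close>

lemma partial_B:
  fixes L R :: "'t sym list"
  assumes "partial (False # bs\<^sub>0) cs\<^sub>0 L R" "cs\<^sub>0 \<noteq> []" "hd cs\<^sub>0"
  shows "B\<^sub>0 \<in> set (L @ R)"
  using assms(1)
proof cases
  case (aligned bs ds cs)
  then have "bs \<noteq> [] \<or> cs \<noteq> []" using assms(2,3) by auto
  then show ?thesis using enc_shift_end[where ?'t = 't, of bs] enc_shift_rev_start[where ?'t = 't, of cs] count_enc_shift(1)[where ?'t = 't, of bs] count_enc_shift(1)[where ?'t = 't, of cs] aligned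
    by (auto simp del: enc_shift_simps)
qed auto

text \<open>The only \<open>A\<^sub>0\<close> belongs to the only complete block left. Inside a run
  there would be a further \<open>B\<^sub>0\<close> beside that block. A block left on the right
  would be the first bit \<open>True\<close>, with two \<open>B\<^sub>0\<close>. So it is the extra
  \<open>False\<close> on the left, and all else has cancelled.\<close>

lemma partial_final:
  fixes L R :: "'t sym list"
  assumes "partial (False # bs\<^sub>0) cs\<^sub>0 L R" "cs\<^sub>0 \<noteq> []" "hd cs\<^sub>0"
    "count_list (L @ R) A\<^sub>0 = 1" "count_list (L @ R) B\<^sub>0 = 1"
  shows "bs\<^sub>0 = cs\<^sub>0"
  using assms(1)
proof cases
  case (aligned bs ds cs)
  have "length bs + length cs = 1"
    using assms(4) aligned by (simp add: count_enc_shift count_list_rev)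
  then consider b where "bs = [b]" "cs = []" | c where "bs = []" "cs = [c]"
    by (cases bs; cases cs) auto
  then show ?thesis
  proof cases
    case 1
    then show ?thesis using aligned by simp
  next
    case 2
    then have "\<not> c" using assms(5) aligned by (cases c) (auto simp: run_def numeral_2_eq_2)
    then show ?thesis using 2 aligned assms(3) by simp
  qed
next
  case (inside bs p ds cs q i j)
  have "length bs + length cs = 1"
    using assms(4) inside by (simp add: count_enc_shift count_list_rev)
  moreover have "count_list (enc_shift bs :: 't sym list) B\<^sub>0 + count_list (enc_shift cs :: 't sym list) B\<^sub>0 + i + j = 1"
    using assms(5) inside by (simp add: count_list_rev count_list_replicate)
  ultimately show ?thesis using count_enc_shift(2)[where ?'t = 't, of bs] count_enc_shift(2)[where ?'t = 't, of cs] inside by linarith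
qed

section \<open>Words without three adjacent markable letters\<close>

fun no_triple :: "('a \<Rightarrow> bool) \<Rightarrow> 'a list \<Rightarrow> bool" where
  "no_triple P (a # b # c # xs) \<longleftrightarrow> \<not> (P a \<and> P b \<and> P c) \<and> no_triple P (b # c # xs)"
| "no_triple P _ \<longleftrightarrow> True"

lemma no_tripleD: "no_triple P (u @ [a, b, c] @ v) \<Longrightarrow> \<not> (P a \<and> P b \<and> P c)"
proof (induction u)
  case (Cons d u)
  then show ?case by (cases u rule: list.exhaust; cases "tl u") auto
qed simp

lemma no_triple_Cons: "\<not> P a \<Longrightarrow> no_triple P (a # xs) = no_triple P xs"
  by (cases xs; cases "tl xs") auto

lemma no_triple_append: "(\<And>a. a \<in> set u \<Longrightarrow> \<not> P a) \<Longrightarrow> no_triple P (u @ xs) = no_triple P xs"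
  by (induction u) (auto simp: no_triple_Cons)

context
  fixes X :: nat
  assumes X: "X = 2 \<or> X = 3"
begin

text \<open>Letters \<open>A\<^sub>0\<close> are isolated, and \<open>B\<^sub>0\<close> occurs in
  runs of at most two.\<close>

lemma no_triple_enc: "no_triple (\<lambda>s. s = S\<^sub>0 \<or> s = C\<^sub>0 \<or> s = Nt X) (B\<^sub>0 # enc bs)"
proof (induction bs)
  case (Cons b bs)
  then show ?case using X
    by (cases bs; cases b) (auto simp: run_def numeral_2_eq_2)
qed simp

text \<open>This rules out a block of three \<open>S\<^sub>0\<close> after marking letters prematurely, while words are still being
  generated.\<close>

lemma no_triple_phase1:
  assumes "bs \<noteq> []" "\<not> last bs"
  shows "no_triple (\<lambda>s. s = S\<^sub>0 \<or> s = C\<^sub>0 \<or> s = Nt X) (map Tm w @ C\<^sub>0 # B\<^sub>0 # enc bs @ S\<^sub>0 # enc cs)"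
proof -
  let ?P = "\<lambda>s. s = S\<^sub>0 \<or> s = C\<^sub>0 \<or> s = Nt X"
  \<comment> \<open>As the last bit is \<open>False\<close>, a single \<open>B\<^sub>0\<close>
    separates the last \<open>A\<^sub>0\<close> from \<open>S\<^sub>0\<close>; with two of them,
    \<open>B\<^sub>0 B\<^sub>0 S\<^sub>0\<close> would be a forbidden triple for
    \<open>X = 3\<close>.\<close>
  have S: "no_triple ?P (B\<^sub>0 # S\<^sub>0 # enc cs)"
  proof (cases cs)
    case (Cons c cs')
    then show ?thesis using no_triple_enc[of cs] X by (cases c; cases cs') (auto simp: run_def numeral_2_eq_2)
  qed simp
  have "no_triple ?P (B\<^sub>0 # enc bs @ S\<^sub>0 # enc cs)" using assms
  proof (induction bs)
    case (Cons b bs)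
    then show ?case using X S
      by (cases bs; cases b) (auto simp: run_def numeral_2_eq_2)
  qed simp
  then have "no_triple ?P (C\<^sub>0 # B\<^sub>0 # enc bs @ S\<^sub>0 # enc cs)" using assms X by (cases bs) auto
  then show ?thesis by (subst no_triple_append) auto
qed

end

section \<open>Marking and checking\<close>

lemma append_Cons_uniqueD:
  assumes "xs @ x # ys = xs' @ x # ys'" "x \<notin> set xs" "x \<notin> set ys"
  shows "xs' = xs" "ys' = ys"
  using append_Cons_eq_iff[OF assms(2,3), of xs' ys'] assms(1) by simp_all

text \<open>Every rule consumes one occurrence of its left side; the balance is written with sums on
  both sides to avoid subtraction. It shows which matrices are blocked and how many markers a matrix
  leaves.\<close>

lemma apply_rules_count:
  "apply_rules rs x y \<Longrightarrow> count_list y c + length (filter (\<lambda>r. Nt (fst r) = c) rs)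
     = count_list x c + sum_list (map (\<lambda>r. count_list (snd r) c) rs)"
proof (induction rs arbitrary: x)
  case (Cons r rs)
  obtain A w where r: "r = (A, w)" by (cases r)
  with Cons.prems obtain u v where "x = u @ [Nt A] @ v" "apply_rules rs (u @ w @ v) y" by auto
  with Cons.IH[of "u @ w @ v"] r show ?case by (auto simp: count_list_append)
qed simp

text \<open>Every rule replaces one letter by the letter \<open>s\<close>, so positions are
  preserved and the changes compose pointwise.\<close>

lemma apply_rules_relabel:
  assumes "apply_rules rs x y" "\<And>r. r \<in> set rs \<Longrightarrow> snd r = [s]"
  shows "list_all2 (\<lambda>a b. a = b \<or> b = s \<and> a \<in> Nt ` fst ` set rs) x y"
  using assms
proof (induction rs arbitrary: x)
  case Nil
  then show ?case by (simp add: list_all2_refl)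
next
  case (Cons r rs)
  let ?R = "\<lambda>rs a b. a = b \<or> b = s \<and> a \<in> Nt ` fst ` set rs"
  obtain A where r: "r = (A, [s])" using Cons.prems(2)[of r] by (cases r) auto
  with Cons.prems obtain u v where x: "x = u @ [Nt A] @ v" and "apply_rules rs (u @ [s] @ v) y" by auto
  then have tl: "list_all2 (?R rs) (u @ [s] @ v) y" using Cons by auto
  have hd: "list_all2 (?R (r # rs)) x (u @ [s] @ v)"
    unfolding x r by (intro list_all2_appendI) (auto simp: list_all2_refl)
  show ?case by (rule list_all2_trans[OF _ hd tl]) auto
qed

text \<open>With \<open>P\<close> selecting the terminals, this recovers the output after
  \<open>stop_rules\<close> has erased nonterminals.\<close>

lemma apply_rules_erase:
  assumes "apply_rules rs x y" "\<And>r. r \<in> set rs \<Longrightarrow> snd r = []" "\<And>A. \<not> P (Nt A)"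
  shows "filter P y = filter P x"
  using assms(1,2)
proof (induction rs arbitrary: x)
  case (Cons r rs)
  obtain A where r: "r = (A, [])" using Cons.prems(2)[of r] by (cases r) auto
  with Cons.prems obtain u v where "x = u @ [Nt A] @ v" "apply_rules rs (u @ v) y" by auto
  with Cons.IH[of "u @ v"] Cons.prems(2) assms(3) show ?case by auto
qed simp

lemma apply_rulesI:
  "x = u @ Nt A # v \<Longrightarrow> apply_rules rs (u @ w @ v) y \<Longrightarrow> apply_rules ((A, w) # rs) x y"
  by auto

lemma delete_from_block:
  assumes "u @ s # v = p @ replicate (Suc n) s @ q" "s \<notin> set p" "s \<notin> set q"
  shows "u @ v = p @ replicate n s @ q"
  using assms(1,2)
proof (induction p arbitrary: u)
  case Nil
  have "u @ s # v = replicate (Suc n) s @ q \<Longrightarrow> u @ v = replicate n s @ q"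
    using assms(3)
  proof (induction n arbitrary: u)
    case 0
    then show ?case by (cases u) auto
  next
    case (Suc n)
    then show ?case by (cases u) auto
  qed
  then show ?case using Nil by simp
next
  case (Cons a p)
  then show ?case by (cases u) auto
qed

text \<open>The three occurrences may be rewritten in any order, but they are adjacent and the only
  ones, so the result does not depend on it.\<close>

lemma collapse_block:
  assumes "apply_rules [(A, []), (A, []), (A, w)] (p @ [Nt A, Nt A, Nt A] @ q) z"
    "Nt A \<notin> set p" "Nt A \<notin> set q"
  shows "z = p @ w @ q"
proof -
  obtain u1 v1 u2 v2 u3 v3 where *:
    "p @ [Nt A, Nt A, Nt A] @ q = u1 @ [Nt A] @ v1"
    "u1 @ v1 = u2 @ [Nt A] @ v2" "u2 @ v2 = u3 @ [Nt A] @ v3" "z = u3 @ w @ v3"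
    using assms(1) by auto
  have "u1 @ v1 = p @ replicate 2 (Nt A) @ q"
    using delete_from_block[of u1 "Nt A" v1 p 2 q] *(1)[symmetric] assms(2,3)
    by (simp add: numeral_2_eq_2)
  then have "u2 @ v2 = p @ replicate 1 (Nt A) @ q"
    using delete_from_block[of u2 "Nt A" v2 p 1 q] *(2) assms(2,3)
    by (simp add: numeral_2_eq_2)
  then have "p @ Nt A # q = u3 @ Nt A # v3" using *(3) by simp
  then show ?thesis using *(4) assms(2,3) by (auto simp: append_Cons_eq_iff)
qed

definition mark_rules :: "nat \<Rightarrow> (nat \<times> 't sym list) list" where
  "mark_rules X = [(4, [S\<^sub>0]), (X, [S\<^sub>0]), (X, [S\<^sub>0])]"

definition check_rules :: "(nat \<times> 't sym list) list" where
  "check_rules = [(5, []), (5, []), (5, [C\<^sub>0])]"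

text \<open>Marking only turns letters into \<open>S\<^sub>0\<close>, so the block traces back
  position by position, and a context that is free of \<open>S\<^sub>0\<close> afterwards was not
  changed.\<close>

lemma mark_factor:
  fixes x y :: "'a sym list"
  assumes "apply_rules (mark_rules X) x y" "y = p @ [S\<^sub>0, S\<^sub>0, S\<^sub>0] @ q"
  shows "\<exists>p' a b c q'. x = p' @ [a, b, c] @ q' \<and> {a, b, c} \<subseteq> {S\<^sub>0, C\<^sub>0, Nt X} \<and>
    (S\<^sub>0 \<notin> set p \<longrightarrow> p' = p) \<and> (S\<^sub>0 \<notin> set q \<longrightarrow> q' = q)"
proof -
  let ?R = "\<lambda>a b. a = b \<or> b = S\<^sub>0 \<and> a \<in> {C\<^sub>0, Nt X}"
  have "list_all2 (\<lambda>a b. a = b \<or> b = S\<^sub>0 \<and> a \<in> Nt ` fst ` set (mark_rules X :: (nat \<times> 'a sym list) list)) x y"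
    by (rule apply_rules_relabel[OF assms(1)]) (auto simp: mark_rules_def)
  then have "list_all2 ?R x y" by (simp add: mark_rules_def)
  then obtain p' m q' where x: "x = p' @ m @ q'" and l: "list_all2 ?R p' p"
    "list_all2 ?R m [S\<^sub>0, S\<^sub>0, S\<^sub>0]" "list_all2 ?R q' q"
    unfolding assms(2) list_all2_append2 by blast
  obtain a b c where "m = [a, b, c]" "{a, b, c} \<subseteq> {S\<^sub>0, C\<^sub>0, Nt X}"
    using l(2) by (auto simp: list_all2_Cons2)
  moreover have "r' = r" if "list_all2 ?R r' r" "S\<^sub>0 \<notin> set r" for r r'
    using that by (induction rule: list_all2_induct) auto
  ultimately show ?thesis using x l by blast
qed

text \<open>Counting shows that marking creates exactly three \<open>S\<^sub>0\<close>, so the block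
  contains them all, and before marking it consisted of \<open>C\<^sub>0\<close> and two letters
  \<open>Nt X\<close>. The three disjuncts are the possible places of \<open>C\<^sub>0\<close> in
  it.\<close>

lemma mark_check_cancel:
  assumes X: "X = 2 \<or> X = 3"
    and ni: "S\<^sub>0 \<notin> set (t @ r)" "C\<^sub>0 \<notin> set (t @ r)"
    and m: "apply_rules (mark_rules X) (t @ C\<^sub>0 # r) y" "factor [S\<^sub>0, S\<^sub>0, S\<^sub>0] y"
    and c: "apply_rules check_rules y z"
  shows "\<exists>t' r'. z = t' @ C\<^sub>0 # r' \<and>
    (t = t' @ [Nt X, Nt X] \<and> r' = r \<or> t = t' @ [Nt X] \<and> r = Nt X # r' \<or> t' = t \<and> r = [Nt X, Nt X] @ r')"
proof -
  obtain p q where y: "y = p @ [S\<^sub>0, S\<^sub>0, S\<^sub>0] @ q" using m(2) by (auto simp: factor_def)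
  have "count_list y S\<^sub>0 = 3" "count_list y C\<^sub>0 = 0"
    using apply_rules_count[OF m(1), of "S\<^sub>0"] apply_rules_count[OF m(1), of "C\<^sub>0"] X ni
    by (auto simp: mark_rules_def count_list_0_iff)
  then have pq: "S\<^sub>0 \<notin> set p" "S\<^sub>0 \<notin> set q" "C\<^sub>0 \<notin> set p" "C\<^sub>0 \<notin> set q"
    by (auto simp: y count_list_0_iff)
  have z: "z = p @ C\<^sub>0 # q"
    using collapse_block[of 5 "[C\<^sub>0]" p q z] c y pq by (simp add: check_rules_def)
  obtain a b c where x: "t @ C\<^sub>0 # r = p @ [a, b, c] @ q" "{a, b, c} \<subseteq> {S\<^sub>0, C\<^sub>0, Nt X}"
    using mark_factor[OF m(1) y] pq by blast
  have "set (p @ [a, b, c] @ q) = insert C\<^sub>0 (set (t @ r))" using x(1)[symmetric] by auto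
  then have "S\<^sub>0 \<notin> set (p @ [a, b, c] @ q)" using ni(1) by simp
  then have "S\<^sub>0 \<notin> {a, b, c}" by auto
  then have abc: "{a, b, c} \<subseteq> {C\<^sub>0, Nt X}" using x(2) by auto
  have "count_list (p @ [a, b, c] @ q) C\<^sub>0 = 1"
    unfolding x(1)[symmetric] using ni(2) by (simp add: count_list_0_iff)
  then have "count_list [a, b, c] C\<^sub>0 = 1"
    using pq by (auto simp: count_list_0_iff split: if_splits)
  then consider "a = C\<^sub>0" "b = Nt X" "c = Nt X" | "a = Nt X" "b = C\<^sub>0" "c = Nt X"
    | "a = Nt X" "b = Nt X" "c = C\<^sub>0"
    using abc X by (auto split: if_splits)
  then show ?thesis
  proof cases
    case 1
    have "t @ C\<^sub>0 # r = p @ C\<^sub>0 # (Nt X # Nt X # q)" using x(1) 1 by simp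
    then have "t = p" "r = Nt X # Nt X # q" using ni(2) by (simp_all add: append_Cons_eq_iff)
    then show ?thesis using z by auto
  next
    case 2
    have "t @ C\<^sub>0 # r = (p @ [Nt X]) @ C\<^sub>0 # (Nt X # q)" using x(1) 2 by simp
    from append_Cons_uniqueD[OF this] have "t = p @ [Nt X]" "r = Nt X # q" using ni(2) by auto
    then show ?thesis using z by auto
  next
    case 3
    have "t @ C\<^sub>0 # r = (p @ [Nt X, Nt X]) @ C\<^sub>0 # q" using x(1) 3 by simp
    from append_Cons_uniqueD[OF this] have "t = p @ [Nt X, Nt X]" "r = q" using ni(2) by auto
    then show ?thesis using z by auto
  qed
qed

lemma map_Tm_append_snoc:
  assumes "map Tm w @ L = t @ [Nt X]"
  shows "\<exists>L'. L = L' @ [Nt X] \<and> t = map Tm w @ L'"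
proof (cases L rule: rev_cases)
  case Nil
  then have "Nt X \<in> set (map Tm w)" using assms by simp
  then show ?thesis by auto
qed (use assms in auto)

text \<open>The cancelled letters are nonterminals, so they lie in \<open>L\<close> or
  \<open>R\<close> and never in the output.\<close>

lemma mark_check_cancel_Tm:
  assumes "X = 2 \<or> X = 3" "set (L @ R) \<subseteq> {A\<^sub>0, B\<^sub>0}"
    and "apply_rules (mark_rules X) (map Tm w @ L @ C\<^sub>0 # R) y" "factor [S\<^sub>0, S\<^sub>0, S\<^sub>0] y"
    and "apply_rules check_rules y z"
  shows "\<exists>L' R'. z = map Tm w @ L' @ C\<^sub>0 # R' \<and> cancel L R L' R'"
proof -
  have "S\<^sub>0 \<notin> set ((map Tm w @ L) @ R)" "C\<^sub>0 \<notin> set ((map Tm w @ L) @ R)" using assms(2) by auto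
  from mark_check_cancel[OF assms(1) this _ assms(4,5)] assms(3)
  obtain t' r' where z: "z = t' @ C\<^sub>0 # r'" and
    "map Tm w @ L = t' @ [Nt X, Nt X] \<and> r' = R \<or> map Tm w @ L = t' @ [Nt X] \<and> R = Nt X # r'
     \<or> t' = map Tm w @ L \<and> R = [Nt X, Nt X] @ r'" by auto
  then consider "map Tm w @ L = (t' @ [Nt X]) @ [Nt X]" "r' = R" | "map Tm w @ L = t' @ [Nt X]" "R = Nt X # r'"
    | "t' = map Tm w @ L" "R = [Nt X, Nt X] @ r'" by auto
  then show ?thesis
  proof cases
    case 1
    then obtain L1 where L1: "L = L1 @ [Nt X]" "map Tm w @ L1 = t' @ [Nt X]"
      using map_Tm_append_snoc by metis
    then obtain L2 where "L1 = L2 @ [Nt X]" "t' = map Tm w @ L2"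
      using map_Tm_append_snoc by metis
    then show ?thesis using L1 1 z by (auto simp: cancel_def)
  next
    case 2
    then obtain L1 where "L = L1 @ [Nt X]" "t' = map Tm w @ L1"
      using map_Tm_append_snoc by metis
    then show ?thesis using 2 z by (auto simp: cancel_def)
  next
    case 3
    then show ?thesis using z by (auto simp: cancel_def)
  qed
qed

section \<open>An SCM grammar for a queue over bits\<close>

text \<open>\<open>b\<^sub>0\<close> is the initial and \<open>f\<^sub>0\<close> the final content
  of the queue, \<open>T\<close> the output alphabet.\<close>

locale bit_queue =
  fixes Q :: "(bool, 't) queue_op set" and b\<^sub>0 f\<^sub>0 :: "bool list" and T :: "'t set"
  assumes finite_ops: "finite Q" and finite_T: "finite T"
    and b\<^sub>0: "framed b\<^sub>0" "b\<^sub>0 \<noteq> []" and f\<^sub>0: "framed f\<^sub>0" "f\<^sub>0 \<noteq> []"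
    and op_framed: "(u, v, e) \<in> Q \<Longrightarrow> framed u \<and> framed v"
    and op_T: "(u, v, e) \<in> Q \<Longrightarrow> set e \<subseteq> T"
begin

definition target :: "'t list set" where
  "target = {emits os |os. set os \<subseteq> Q \<and> b\<^sub>0 @ pushes os = pops os @ f\<^sub>0}"

text \<open>The \<open>B\<^sub>0\<close> in front of \<open>enc b\<^sub>0\<close> becomes the extra
  bit \<open>False\<close> in the shifted reading.\<close>

definition init_rules :: "(nat \<times> 't sym list) list" where
  "init_rules = [(4, C\<^sub>0 # B\<^sub>0 # enc b\<^sub>0 @ [S\<^sub>0])]"

text \<open>Pushed words are added left of \<open>S\<^sub>0\<close>, popped words mirrored on its
  right, so that the latest ones are nearest to it. The output grows in front of
  \<open>C\<^sub>0\<close>.\<close>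

definition op_rules :: "(bool, 't) queue_op \<Rightarrow> (nat \<times> 't sym list) list" where
  "op_rules p = (case p of (u, v, e) \<Rightarrow>
     [(5, enc u @ S\<^sub>0 # enc (rev v)), (4, map Tm e @ [C\<^sub>0])])"

text \<open>The new \<open>A\<^sub>0\<close> turns the word on the left from \<open>enc\<close> into
  \<open>enc_shift\<close> form, and \<open>C\<^sub>0\<close> becomes the centre.\<close>

definition turn_rules :: "(nat \<times> 't sym list) list" where
  "turn_rules = [(4, []), (5, A\<^sub>0 # C\<^sub>0 # enc (rev f\<^sub>0))]"

text \<open>Besides \<open>C\<^sub>0\<close>, a successful run removes here the block of the extra
  bit \<open>False\<close>.\<close>

definition stop_rules :: "(nat \<times> 't sym list) list" where
  "stop_rules = [(4, []), (3, []), (2, [])]"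

definition grammar :: "'t scm_grammar" where
  "grammar = \<lparr>gV = Tm ` T \<union> {A\<^sub>0, B\<^sub>0, C\<^sub>0, S\<^sub>0},
    gM = {\<lparr>mrules = init_rules, mP = None, mF = Some [B\<^sub>0]\<rparr>,
        \<lparr>mrules = check_rules, mP = Some [S\<^sub>0, S\<^sub>0, S\<^sub>0], mF = None\<rparr>}
      \<union> (\<lambda>rs. \<lparr>mrules = rs, mP = None, mF = None\<rparr>) `
          ({turn_rules, stop_rules, mark_rules 2, mark_rules 3} \<union> op_rules ` Q),
    gS = 4\<rparr>"

lemma step_iff:
  "scm_step grammar x y \<longleftrightarrow>
     B\<^sub>0 \<notin> set x \<and> apply_rules init_rules x y
   \<or> factor [S\<^sub>0, S\<^sub>0, S\<^sub>0] x \<and> apply_rules check_rules x y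
   \<or> apply_rules turn_rules x y \<or> apply_rules stop_rules x y
   \<or> (\<exists>X. (X = 2 \<or> X = 3) \<and> apply_rules (mark_rules X) x y)
   \<or> (\<exists>p\<in>Q. apply_rules (op_rules p) x y)"
proof -
  have "factor [s] x \<longleftrightarrow> s \<in> set x" for s by (auto simp: factor_def in_set_conv_decomp)
  then show ?thesis unfolding scm_step_def matrix_step_def grammar_def by auto
qed

lemma framed_pushes_pops:
  assumes "set os \<subseteq> Q"
  shows "framed (pushes os)" "framed (pops os)"
proof -
  have "framed (pushes os) \<and> framed (pops os)" using assms
  proof (induction os)
    case (Cons p os)
    obtain u v e where p: "p = (u, v, e)" by (cases p)
    with Cons op_framed[of u v e] show ?case by (auto intro: framed_append)
  qed (simp add: framed_def)
  then show "framed (pushes os)" "framed (pops os)" by auto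
qed

lemma pops_end:
  assumes "set os \<subseteq> Q"
  shows "pops os @ f\<^sub>0 \<noteq> []" "hd (pops os @ f\<^sub>0)"
  using framed_append[OF framed_pushes_pops(2)[OF assms] f\<^sub>0(1)] f\<^sub>0(2) by (auto simp: framed_def)

lemma pushes_end:
  assumes "set os \<subseteq> Q"
  shows "b\<^sub>0 @ pushes os \<noteq> []" "\<not> last (b\<^sub>0 @ pushes os)"
  using framed_append[OF b\<^sub>0(1) framed_pushes_pops(1)[OF assms]] b\<^sub>0(2) by (auto simp: framed_def)

text \<open>In the first phase \<open>S\<^sub>0\<close> is the place where the two words grow and \<open>C\<^sub>0\<close> the place where the output
  grows; every matrix applied there needs both. In the second phase \<open>C\<^sub>0\<close> is the centre, and \<open>S\<^sub>0\<close>
  occurs only while three symbols are marked for removal, when there is no \<open>C\<^sub>0\<close>.\<close>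

definition phase1 :: "(bool, 't) queue_op list \<Rightarrow> 't sym list" where
  "phase1 os = map Tm (emits os) @ C\<^sub>0 # B\<^sub>0 # enc (b\<^sub>0 @ pushes os) @ S\<^sub>0 # enc (rev (pops os))"

definition phase2 :: "(bool, 't) queue_op list \<Rightarrow> 't sym list \<Rightarrow> 't sym list \<Rightarrow> 't sym list" where
  "phase2 os L R = map Tm (emits os) @ L @ C\<^sub>0 # R"

abbreviation partial_run where
  "partial_run os L R \<equiv> set os \<subseteq> Q \<and> partial (False # b\<^sub>0 @ pushes os) (pops os @ f\<^sub>0) L R"

text \<open>Words under \<open>dead\<close> have no successor, as \<open>step_without_C\<close>
  shows; only a terminal one among them contributes to the language.\<close>

inductive inv :: "'t sym list \<Rightarrow> bool" where
  start: "inv [C\<^sub>0]"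
| phase1: "set os \<subseteq> Q \<Longrightarrow> inv (phase1 os)"
| phase2: "partial_run os L R \<Longrightarrow> inv (phase2 os L R)"
| marked: "partial_run os L R \<Longrightarrow> X = 2 \<or> X = 3 \<Longrightarrow> apply_rules (mark_rules X) (phase2 os L R) y \<Longrightarrow>
    factor [S\<^sub>0, S\<^sub>0, S\<^sub>0] y \<Longrightarrow> inv y"
| dead: "C\<^sub>0 \<notin> set y \<Longrightarrow> \<not> factor [S\<^sub>0, S\<^sub>0, S\<^sub>0] y \<Longrightarrow>
    (\<And>w. y = map Tm w \<Longrightarrow> w \<in> target) \<Longrightarrow> inv y"

section \<open>Preservation of the invariant\<close>

lemma factor_SSS_count: "factor [S\<^sub>0, S\<^sub>0, S\<^sub>0] y \<Longrightarrow> 3 \<le> count_list y S\<^sub>0"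
  by (auto simp: factor_def)

lemma dead_if_S:
  assumes "C\<^sub>0 \<notin> set y" "\<not> factor [S\<^sub>0, S\<^sub>0, S\<^sub>0] y" "0 < count_list y S\<^sub>0"
  shows "inv y"
proof (rule dead)
  fix w assume "y = map Tm w"
  then have "S\<^sub>0 \<notin> set y" by auto
  then show "w \<in> target" using assms(3) by (simp add: count_list_0_iff)
qed (use assms in auto)

lemma partial_set: "partial bs cs L R \<Longrightarrow> set (L @ R) \<subseteq> {A\<^sub>0, B\<^sub>0}"
  using set_enc_shift by (fastforce elim: partial.cases)

text \<open>Every matrix except that of \<open>check_rules\<close> rewrites
  \<open>C\<^sub>0\<close>, and no earlier rule of the same matrix creates one.\<close>

lemma step_without_C:
  assumes "scm_step grammar x y" "C\<^sub>0 \<notin> set x"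
  shows "factor [S\<^sub>0, S\<^sub>0, S\<^sub>0] x \<and> apply_rules check_rules x y"
proof -
  have "\<not> apply_rules (op_rules p) x y" for p
  proof
    obtain u v e where p: "p = (u, v, e)" by (cases p)
    assume "apply_rules (op_rules p) x y"
    then obtain x1 x2 y1 y2 where "x = x1 @ S\<^sub>0 # x2" "x1 @ enc u @ S\<^sub>0 # enc (rev v) @ x2 = y1 @ C\<^sub>0 # y2"
      unfolding op_rules_def p by auto
    moreover have "C\<^sub>0 \<in> set (y1 @ C\<^sub>0 # y2)" by simp
    ultimately have "C\<^sub>0 \<in> set (x1 @ enc u @ S\<^sub>0 # enc (rev v) @ x2)" by metis
    then show False using set_enc[where ?'a = 't, of u] set_enc[where ?'a = 't, of "rev v"] \<open>x = _\<close> assms(2) by auto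
  qed
  then show ?thesis using assms unfolding step_iff
    by (auto simp: init_rules_def turn_rules_def stop_rules_def mark_rules_def)
qed

lemma enc_count [simp]: "count_list (enc bs) C\<^sub>0 = 0" "count_list (enc bs) S\<^sub>0 = 0"
  by (induction bs) (auto simp: count_list_replicate)

lemma enc_notin [simp]: "C\<^sub>0 \<notin> set (enc bs)" "S\<^sub>0 \<notin> set (enc bs)"
  using set_enc by fastforce+

lemma map_Tm_count [simp]: "count_list (map Tm w) (Nt X) = 0"
  by (induction w) auto

lemma phase1_count: "count_list (phase1 os) C\<^sub>0 = 1" "count_list (phase1 os) S\<^sub>0 = 1"
  by (simp_all add: phase1_def)

lemma phase1_step:
  assumes os: "set os \<subseteq> Q" and step: "scm_step grammar (phase1 os) y"
  shows "inv y"
proof -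
  have B: "B\<^sub>0 \<in> set (phase1 os)" by (simp add: phase1_def)
  from step consider (check) "apply_rules check_rules (phase1 os) y"
    | (turn) "apply_rules turn_rules (phase1 os) y" | (stop) "apply_rules stop_rules (phase1 os) y"
    | (mark) X where "X = 2 \<or> X = 3" "apply_rules (mark_rules X) (phase1 os) y"
    | (op) u v e where "(u, v, e) \<in> Q" "apply_rules (op_rules (u, v, e)) (phase1 os) y"
    unfolding step_iff using B by auto
  then show ?thesis
  proof cases
    case check
    then show ?thesis using apply_rules_count[OF check, of "S\<^sub>0"] phase1_count(2)[of os]
      by (simp add: check_rules_def)
  next
    case turn
    let ?l = "map Tm (emits os)" and ?r = "B\<^sub>0 # enc (b\<^sub>0 @ pushes os) @ S\<^sub>0 # enc (rev (pops os))"
    obtain u v u' v' where 1: "?l @ C\<^sub>0 # ?r = u @ C\<^sub>0 # v" "u @ v = u' @ S\<^sub>0 # v'"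
      "y = u' @ A\<^sub>0 # C\<^sub>0 # enc (rev f\<^sub>0) @ v'"
      using turn by (auto simp: turn_rules_def phase1_def)
    have "C\<^sub>0 \<notin> set ?l" "C\<^sub>0 \<notin> set ?r" by (auto simp del: enc_simps)
    from append_Cons_uniqueD[OF 1(1) this] have "u = ?l" "v = ?r" .
    then have 2: "(?l @ B\<^sub>0 # enc (b\<^sub>0 @ pushes os)) @ S\<^sub>0 # enc (rev (pops os)) = u' @ S\<^sub>0 # v'"
      using 1(2) by simp
    have "S\<^sub>0 \<notin> set (?l @ B\<^sub>0 # enc (b\<^sub>0 @ pushes os))" "S\<^sub>0 \<notin> set (enc (rev (pops os)) :: 't sym list)"
      by (auto simp del: enc_simps)
    from append_Cons_uniqueD[OF 2 this]
    have uv: "u' = ?l @ B\<^sub>0 # enc (b\<^sub>0 @ pushes os)" "v' = enc (rev (pops os))" .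
    \<comment> \<open>The leading \<open>B\<^sub>0\<close> reads as the run of a bit
      \<open>False\<close>; this is the bit put in front in \<open>partial_run\<close>.\<close>
    have L: "(B\<^sub>0 # enc (b\<^sub>0 @ pushes os)) @ [A\<^sub>0] = enc_shift (False # b\<^sub>0 @ pushes os)"
      using enc_snoc_eq_enc_shift[of "b\<^sub>0 @ pushes os"] by (simp add: run_def)
    have R: "enc (rev f\<^sub>0) @ enc (rev (pops os)) = rev (enc_shift (pops os @ f\<^sub>0))"
      by (simp add: enc_rev_eq_enc_shift)
    have "y = ?l @ ((B\<^sub>0 # enc (b\<^sub>0 @ pushes os)) @ [A\<^sub>0]) @ C\<^sub>0 # (enc (rev f\<^sub>0) @ enc (rev (pops os)))"
      using 1(3) uv by simp
    then have "y = phase2 os (enc_shift (False # b\<^sub>0 @ pushes os)) (rev (enc_shift (pops os @ f\<^sub>0)))"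
      unfolding L R phase2_def .
    moreover have "partial (False # b\<^sub>0 @ pushes os) (pops os @ f\<^sub>0)
        (enc_shift (False # b\<^sub>0 @ pushes os)) (rev (enc_shift (pops os @ f\<^sub>0)) :: 't sym list)"
      by (rule partial.aligned[of _ _ "[]"]) simp_all
    ultimately show ?thesis using inv.phase2 os by blast
  next
    case stop
    \<comment> \<open>One \<open>S\<^sub>0\<close> stays behind without any
      \<open>C\<^sub>0\<close>, so the derivation is stuck at a nonterminal word.\<close>
    then have "count_list y C\<^sub>0 = 0" "count_list y S\<^sub>0 = 1"
      using apply_rules_count[OF stop, of "C\<^sub>0"] apply_rules_count[OF stop, of "S\<^sub>0"] phase1_count[of os]
      by (auto simp: stop_rules_def)
    then show ?thesis using dead_if_S[of y] factor_SSS_count[of y] by (auto simp: count_list_0_iff)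
  next
    case (mark X)
    then have c: "count_list y C\<^sub>0 = 0" "count_list y S\<^sub>0 = 4"
      using apply_rules_count[OF mark(2), of "C\<^sub>0"] apply_rules_count[OF mark(2), of "S\<^sub>0"] phase1_count[of os]
      by (auto simp: mark_rules_def)
    have "\<not> factor [S\<^sub>0, S\<^sub>0, S\<^sub>0] y"
    proof
      assume "factor [S\<^sub>0, S\<^sub>0, S\<^sub>0] y"
      then obtain p q where "y = p @ [S\<^sub>0, S\<^sub>0, S\<^sub>0] @ q" by (auto simp: factor_def)
      from mark_factor[OF mark(2) this] obtain p' a b c q' where
        "phase1 os = p' @ [a, b, c] @ q'" "{a, b, c} \<subseteq> {S\<^sub>0, C\<^sub>0, Nt X}"
        by (elim exE conjE) (rule that)
      moreover have "no_triple (\<lambda>s. s = S\<^sub>0 \<or> s = C\<^sub>0 \<or> s = Nt X) (phase1 os)"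
        unfolding phase1_def by (rule no_triple_phase1[OF mark(1) pushes_end[OF os]])
      ultimately show False using no_tripleD[of "\<lambda>s. s = S\<^sub>0 \<or> s = C\<^sub>0 \<or> s = Nt X" p' a b c q'] by auto
    qed
    then show ?thesis using dead_if_S[of y] c by (auto simp: count_list_0_iff)
  next
    case (op u v e)
    let ?l = "map Tm (emits os) @ C\<^sub>0 # B\<^sub>0 # enc (b\<^sub>0 @ pushes os)" and ?r = "enc (rev (pops os))"
    obtain x1 x2 x3 x4 where 1: "?l @ S\<^sub>0 # ?r = x1 @ S\<^sub>0 # x2"
      "x1 @ enc u @ S\<^sub>0 # enc (rev v) @ x2 = x3 @ C\<^sub>0 # x4" "y = x3 @ map Tm e @ C\<^sub>0 # x4"
      using op(2) by (auto simp: op_rules_def phase1_def)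
    have "S\<^sub>0 \<notin> set ?l" "S\<^sub>0 \<notin> set ?r"
      by (auto simp del: enc_simps)
    from append_Cons_uniqueD[OF 1(1) this] have x12: "x1 = ?l" "x2 = ?r" .
    have 2: "map Tm (emits os) @ C\<^sub>0 # (B\<^sub>0 # enc (b\<^sub>0 @ pushes os) @ enc u @ S\<^sub>0 # enc (rev v) @ ?r) = x3 @ C\<^sub>0 # x4"
      using 1(2) x12 by simp
    have "C\<^sub>0 \<notin> set (map Tm (emits os))"
      "C\<^sub>0 \<notin> set (B\<^sub>0 # enc (b\<^sub>0 @ pushes os) @ enc u @ S\<^sub>0 # enc (rev v) @ ?r)"
      by (auto simp del: enc_simps)
    from append_Cons_uniqueD[OF 2 this] have "y = phase1 (os @ [(u, v, e)])" using 1(3) by (simp add: phase1_def)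
    then show ?thesis using phase1[of "os @ [(u, v, e)]"] os op(1) by simp
  qed
qed

lemma phase2_step:
  assumes pr: "partial_run os L R" and step: "scm_step grammar (phase2 os L R) y"
  shows "inv y"
proof -
  have LR: "set (L @ R) \<subseteq> {A\<^sub>0, B\<^sub>0}" using pr partial_set by blast
  have "B\<^sub>0 \<in> set (L @ R)" using pr partial_B pops_end by blast
  then have B: "B\<^sub>0 \<in> set (phase2 os L R)" by (auto simp: phase2_def)
  have S: "S\<^sub>0 \<notin> set (phase2 os L R)" using LR by (auto simp: phase2_def)
  then have S0: "count_list (phase2 os L R) S\<^sub>0 = 0" by (simp add: count_list_0_iff)
  have "C\<^sub>0 \<notin> set L" "C\<^sub>0 \<notin> set R" using LR by auto
  then have C1: "count_list (phase2 os L R) C\<^sub>0 = 1"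
    by (simp add: phase2_def count_list_0_iff)
  have "\<not> factor [S\<^sub>0, S\<^sub>0, S\<^sub>0] (phase2 os L R)" using S by (auto simp: factor_def)
  moreover have "\<not> apply_rules (op_rules p) (phase2 os L R) y" for p
    using S by (cases p) (auto simp: op_rules_def)
  moreover have "\<not> apply_rules turn_rules (phase2 os L R) y"
    using apply_rules_count[of turn_rules "phase2 os L R" y "S\<^sub>0"] S0 by (auto simp: turn_rules_def)
  ultimately consider (stop) "apply_rules stop_rules (phase2 os L R) y"
    | (mark) X where "X = 2 \<or> X = 3" "apply_rules (mark_rules X) (phase2 os L R) y"
    using step B unfolding step_iff by blast
  then show ?thesis
  proof cases
    case (mark X)
    then have c: "count_list y C\<^sub>0 = 0" "count_list y S\<^sub>0 = 3"
      using apply_rules_count[OF mark(2), of "C\<^sub>0"] apply_rules_count[OF mark(2), of "S\<^sub>0"] C1 S0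
      by (auto simp: mark_rules_def)
    show ?thesis
    proof (cases "factor [S\<^sub>0, S\<^sub>0, S\<^sub>0] y")
      case True
      then show ?thesis using marked pr mark by blast
    next
      case False
      then show ?thesis using dead_if_S[of y] c by (auto simp: count_list_0_iff)
    qed
  next
    case stop
    have cnt: "count_list y s + length (filter (\<lambda>r. Nt (fst r) = s) stop_rules) = count_list (phase2 os L R) s" for s
      using apply_rules_count[OF stop, of s] by (simp add: stop_rules_def)
    have "count_list y C\<^sub>0 = 0" "count_list y S\<^sub>0 = 0"
      using cnt[of "C\<^sub>0"] cnt[of "S\<^sub>0"] C1 S0 by (auto simp: stop_rules_def)
    moreover have "w \<in> target" if y: "y = map Tm w" for w
    proof -
      \<comment> \<open>A terminal result means that \<open>stop_rules\<close> removed every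
        nonterminal, so exactly one \<open>A\<^sub>0\<close> and one \<open>B\<^sub>0\<close> were
        left.\<close>
      have "count_list (L @ R) A\<^sub>0 = 1" "count_list (L @ R) B\<^sub>0 = 1"
        using cnt[of "A\<^sub>0"] cnt[of "B\<^sub>0"] y by (auto simp: stop_rules_def phase2_def)
      then have eq: "b\<^sub>0 @ pushes os = pops os @ f\<^sub>0" using partial_final pr pops_end by blast
      let ?P = "\<lambda>s. \<exists>a. s = (Tm a :: 't sym)"
      have "filter ?P y = filter ?P (phase2 os L R)"
        by (rule apply_rules_erase[OF stop]) (auto simp: stop_rules_def)
      moreover have "filter ?P L = []" "filter ?P R = []" using LR by (auto simp: filter_empty_conv)
      moreover have "filter ?P (map Tm v) = map Tm v" for v by (induction v) auto
      ultimately have "map Tm w = (map Tm (emits os) :: 't sym list)" using y by (simp add: phase2_def)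
      then have "w = emits os" by (simp add: inj_map_eq_map inj_def)
      then show ?thesis using eq pr by (auto simp: target_def)
    qed
    ultimately show ?thesis using dead[of y] factor_SSS_count[of y] by (auto simp: count_list_0_iff)
  qed
qed

lemma inv_step:
  assumes "inv x" "scm_step grammar x y"
  shows "inv y"
  using assms(1)
proof cases
  case start
  have "\<not> factor [S\<^sub>0, S\<^sub>0, S\<^sub>0] [C\<^sub>0]" using factor_SSS_count by fastforce
  then have "apply_rules init_rules [C\<^sub>0] y"
    using assms(2) start unfolding step_iff
    by (auto simp: turn_rules_def stop_rules_def mark_rules_def op_rules_def Cons_eq_append_conv split: prod.splits)
  then have "y = phase1 []" by (auto simp: init_rules_def phase1_def Cons_eq_append_conv)
  then show ?thesis using phase1[of "[]"] by simp
next
  case (phase1 os)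
  then show ?thesis using phase1_step assms(2) by simp
next
  case (phase2 os L R)
  then show ?thesis using phase2_step assms(2) by simp
next
  case (marked os L R X)
  have LR: "set (L @ R) \<subseteq> {A\<^sub>0, B\<^sub>0}" using marked(1) partial_set by blast
  then have "C\<^sub>0 \<notin> set L" "C\<^sub>0 \<notin> set R" by auto
  then have "count_list x C\<^sub>0 = 0"
    using apply_rules_count[OF marked(3), of "C\<^sub>0"] marked(2)
    by (auto simp: mark_rules_def phase2_def count_list_0_iff)
  then have "apply_rules check_rules x y" using step_without_C[OF assms(2)] by (simp add: count_list_0_iff)
  then obtain L' R' where "y = phase2 os L' R'" "cancel L R L' R'"
    using mark_check_cancel_Tm[OF marked(2) LR _ marked(4)] marked(3) unfolding phase2_def by blast
  then show ?thesis using inv.phase2 partial_cancel marked(1) by blast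
next
  case dead
  then show ?thesis using step_without_C[OF assms(2)] by blast
qed

lemma lang_subset_target: "scm_lang grammar \<subseteq> target"
proof
  fix w assume "w \<in> scm_lang grammar"
  then have r: "(scm_step grammar)\<^sup>*\<^sup>* [C\<^sub>0] (map Tm w)" by (simp add: scm_lang_def grammar_def)
  have "inv y" if "(scm_step grammar)\<^sup>*\<^sup>* [C\<^sub>0] y" for y
    using that by induction (auto intro: inv.start inv_step)
  from this[OF r] show "w \<in> target"
  proof cases
    case (phase1 os)
    then have "C\<^sub>0 \<in> set (map Tm w)" by (simp add: phase1_def)
    then show ?thesis by auto
  next
    case (phase2 os L R)
    then have "C\<^sub>0 \<in> set (map Tm w)" by (simp add: phase2_def)
    then show ?thesis by auto
  next
    case (marked os L R X)
    then obtain u v where "map Tm w = u @ [S\<^sub>0, S\<^sub>0, S\<^sub>0] @ v" by (auto simp: factor_def)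
    then have "S\<^sub>0 \<in> set (map Tm w)" by simp
    then show ?thesis by auto
  qed auto
qed

section \<open>Every output of the queue is generated\<close>

abbreviation "steps \<equiv> (scm_step grammar)\<^sup>*\<^sup>*"

lemma steps_cancel:
  assumes "X = 2 \<or> X = 3"
  shows "steps (t @ Nt X # C\<^sub>0 # Nt X # r) (t @ C\<^sub>0 # r)"
proof -
  have m: "apply_rules (mark_rules X) (t @ Nt X # C\<^sub>0 # Nt X # r) (t @ [S\<^sub>0, S\<^sub>0, S\<^sub>0] @ r)"
    unfolding mark_rules_def
    by (intro apply_rulesI[of _ "t @ [Nt X]" _ "Nt X # r"] apply_rulesI[of _ t _ "[S\<^sub>0, Nt X] @ r"]
        apply_rulesI[of _ "t @ [S\<^sub>0, S\<^sub>0]" _ r]) auto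
  have "scm_step grammar (t @ Nt X # C\<^sub>0 # Nt X # r) (t @ [S\<^sub>0, S\<^sub>0, S\<^sub>0] @ r)"
    unfolding step_iff using m assms by blast
  moreover have "apply_rules check_rules (t @ [S\<^sub>0, S\<^sub>0, S\<^sub>0] @ r) (t @ C\<^sub>0 # r)"
    unfolding check_rules_def
    by (intro apply_rulesI[of _ t _ "[S\<^sub>0, S\<^sub>0] @ r"] apply_rulesI[of _ t _ "[S\<^sub>0] @ r"]
        apply_rulesI[of _ t _ r]) auto
  moreover have "factor [S\<^sub>0, S\<^sub>0, S\<^sub>0] (t @ [S\<^sub>0, S\<^sub>0, S\<^sub>0] @ r)" by (auto simp: factor_def)
  ultimately have "steps (t @ Nt X # C\<^sub>0 # Nt X # r) (t @ [S\<^sub>0, S\<^sub>0, S\<^sub>0] @ r)"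
    "scm_step grammar (t @ [S\<^sub>0, S\<^sub>0, S\<^sub>0] @ r) (t @ C\<^sub>0 # r)"
    by (simp, unfold step_iff, blast)
  then show ?thesis by (rule rtranclp.rtrancl_into_rtrancl)
qed

lemma steps_cancel_all:
  assumes "set s \<subseteq> {A\<^sub>0, B\<^sub>0}"
  shows "steps (t @ s @ C\<^sub>0 # rev s @ r) (t @ C\<^sub>0 # r)"
  using assms
proof (induction s arbitrary: t r)
  case (Cons a s)
  have "steps (t @ (a # s) @ C\<^sub>0 # rev (a # s) @ r) (t @ a # C\<^sub>0 # a # r)"
    using Cons.IH[of "t @ [a]" "a # r"] Cons.prems by simp
  also have "steps \<dots> (t @ C\<^sub>0 # r)" using Cons.prems steps_cancel[of 2 t r] steps_cancel[of 3 t r] by auto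
  finally show ?case .
qed simp

lemma steps_phase1:
  assumes "set os \<subseteq> Q"
  shows "steps [C\<^sub>0] (phase1 os)"
  using assms
proof (induction os rule: rev_induct)
  case Nil
  have "apply_rules init_rules [C\<^sub>0] (phase1 [])"
    unfolding init_rules_def by (rule apply_rulesI[of _ "[]" _ "[]"]) (auto simp: phase1_def)
  then have "scm_step grammar [C\<^sub>0] (phase1 [])" unfolding step_iff by simp
  then show ?case by blast
next
  case (snoc p os)
  obtain u v e where p: "p = (u, v, e)" by (cases p)
  have "apply_rules (op_rules p) (phase1 os) (phase1 (os @ [p]))"
    unfolding op_rules_def p prod.case
    by (rule apply_rulesI[of _ "map Tm (emits os) @ C\<^sub>0 # B\<^sub>0 # enc (b\<^sub>0 @ pushes os)" _ "enc (rev (pops os))"],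
        simp add: phase1_def,
        rule apply_rulesI[of _ "map Tm (emits os)" _
          "B\<^sub>0 # enc (b\<^sub>0 @ pushes os) @ enc u @ S\<^sub>0 # enc (rev v) @ enc (rev (pops os))"])
      (simp_all add: phase1_def)
  then have "scm_step grammar (phase1 os) (phase1 (os @ [p]))" unfolding step_iff using snoc.prems by auto
  with snoc show ?case by (auto intro: rtranclp.rtrancl_into_rtrancl)
qed

lemma target_subset_lang: "target \<subseteq> scm_lang grammar"
proof
  fix w assume "w \<in> target"
  then obtain os where os: "set os \<subseteq> Q" and eq: "b\<^sub>0 @ pushes os = pops os @ f\<^sub>0" and w: "w = emits os"
    unfolding target_def by blast
  let ?L = "B\<^sub>0 # enc (b\<^sub>0 @ pushes os) @ [A\<^sub>0]" and ?bs = "b\<^sub>0 @ pushes os"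
  have "enc (rev ?bs) = (enc (rev (pops os @ f\<^sub>0)) :: 't sym list)" unfolding eq ..
  then have R: "(enc (rev (pushes os)) @ enc (rev b\<^sub>0) :: 't sym list) = enc (rev f\<^sub>0) @ enc (rev (pops os))" by simp
  have t: "apply_rules turn_rules (phase1 os) (map Tm w @ ?L @ C\<^sub>0 # enc (rev ?bs))"
    unfolding turn_rules_def
    by (rule apply_rulesI[of _ "map Tm w" _ "B\<^sub>0 # enc (b\<^sub>0 @ pushes os) @ S\<^sub>0 # enc (rev (pops os))"],
        simp add: phase1_def w,
        rule apply_rulesI[of _ "map Tm w @ B\<^sub>0 # enc (b\<^sub>0 @ pushes os)" _ "enc (rev (pops os))"])
      (simp_all add: R)
  \<comment> \<open>The letters \<open>B\<^sub>0 A\<^sub>0\<close> after the output are set aside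
    for \<open>stop_rules\<close>; the rest is a palindrome around \<open>C\<^sub>0\<close> and
    cancels.\<close>
  have s: "map Tm w @ ?L @ C\<^sub>0 # enc (rev ?bs) = (map Tm w @ [B\<^sub>0, A\<^sub>0]) @ enc_shift ?bs @ C\<^sub>0 # rev (enc_shift ?bs) @ []"
  proof -
    have "map Tm w @ ?L @ C\<^sub>0 # enc (rev ?bs) = map Tm w @ [B\<^sub>0] @ (enc ?bs @ [A\<^sub>0]) @ C\<^sub>0 # enc (rev ?bs)"
      by simp
    then show ?thesis unfolding enc_snoc_eq_enc_shift enc_rev_eq_enc_shift by simp
  qed
  have "steps [C\<^sub>0] (phase1 os)" using steps_phase1[OF os] .
  also have "steps \<dots> (map Tm w @ ?L @ C\<^sub>0 # enc (rev ?bs))"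
    using t unfolding step_iff by (auto intro!: r_into_rtranclp simp: step_iff)
  also have "steps \<dots> ((map Tm w @ [B\<^sub>0, A\<^sub>0]) @ C\<^sub>0 # [])"
    unfolding s by (rule steps_cancel_all[OF set_enc_shift])
  also have "apply_rules stop_rules ((map Tm w @ [B\<^sub>0, A\<^sub>0]) @ C\<^sub>0 # []) (map Tm w)"
    unfolding stop_rules_def
    by (rule apply_rulesI[of _ "map Tm w @ [B\<^sub>0, A\<^sub>0]" _ "[]"], simp,
        rule apply_rulesI[of _ "map Tm w" _ "[A\<^sub>0]"], simp,
        rule apply_rulesI[of _ "map Tm w" _ "[]"]) simp_all
  then have "steps ((map Tm w @ [B\<^sub>0, A\<^sub>0]) @ C\<^sub>0 # []) (map Tm w)"
    by (auto intro!: r_into_rtranclp simp: step_iff)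
  finally show "w \<in> scm_lang grammar" by (simp add: scm_lang_def grammar_def)
qed

section \<open>The parameters of the grammar\<close>

lemma target_in_SSCM: "target \<in> SSCM (Some 3) (Some 1) (Some 4) (Some 3) (Some 3)"
proof -
  have wf: "scm_grammar grammar"
    unfolding scm_grammar_def
  proof (intro conjI ballI)
    show "finite (gV grammar)" "Nt (gS grammar) \<in> gV grammar" "finite (gM grammar)"
      using finite_ops finite_T by (auto simp: grammar_def)
    fix r assume "r \<in> gM grammar"
    moreover have "set (enc bs) \<subseteq> gV grammar" for bs
      using set_enc[where ?'a = 't, of bs] by (auto simp: grammar_def)
    moreover have "Tm ` set e \<subseteq> gV grammar" if "(u, v, e) \<in> Q" for u v e
      using op_T[OF that] by (auto simp: grammar_def)
    moreover have "{A\<^sub>0, B\<^sub>0, C\<^sub>0, S\<^sub>0} \<subseteq> gV grammar" by (auto simp: grammar_def)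
    ultimately show "wf_matrix (gV grammar) r"
      unfolding grammar_def scm_grammar.simps
      by (fastforce simp: wf_matrix_def wf_cond_def init_rules_def check_rules_def turn_rules_def
          stop_rules_def mark_rules_def op_rules_def)
  qed
  have "nonterms (gV grammar) = {2, 3, 4, 5}" by (auto simp: nonterms_def grammar_def)
  then have n: "card (nonterms (gV grammar)) \<le> 4" by simp
  have "{r \<in> gM grammar. conditional r} \<subseteq>
    {\<lparr>mrules = init_rules, mP = None, mF = Some [B\<^sub>0]\<rparr>,
     \<lparr>mrules = check_rules, mP = Some [S\<^sub>0, S\<^sub>0, S\<^sub>0], mF = None\<rparr>}"
    by (auto simp: grammar_def conditional_def)
  from card_mono[OF _ this] have m: "card {r \<in> gM grammar. conditional r} \<le> 3"
    by (simp add: card_insert_if split: if_splits)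
  have "{r \<in> gM grammar. non_simple r} = {}" by (auto simp: grammar_def non_simple_def)
  then have ns: "card {r \<in> gM grammar. non_simple r} = 0" by (simp only: card.empty)
  have d: "cond_len (mP r) \<le> 3 \<and> cond_len (mF r) \<le> 1 \<and> length (mrules r) \<le> 3" if "r \<in> gM grammar" for r
    using that by (auto simp: grammar_def cond_len_def init_rules_def check_rules_def turn_rules_def
        stop_rules_def mark_rules_def op_rules_def split: prod.splits)
  show ?thesis unfolding SSCM_def SCM_def bnd_def
    using wf n m ns d lang_subset_target target_subset_lang
    by (auto intro!: exI[of _ grammar])
qed

end

section \<open>From queues over grammar symbols to queues over bits\<close>

lemma RE_subset_SSCM: "(RE :: 't list set set) \<subseteq> SSCM (Some 3) (Some 1) (Some 4) (Some 3) (Some 3)"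
proof
  fix L :: "'t list set" assume "L \<in> RE"
  then obtain G :: "'t ps_grammar" where G: "ps_grammar G" and L: "L = ps_lang G"
    unfolding RE_def by blast
  define A where "A = insert None (Some ` pV G)"
  have "finite A" using G by (simp add: A_def ps_grammar_def)
  then obtain \<kappa> :: "'t sym option \<Rightarrow> nat" where \<kappa>: "inj_on \<kappa> A"
    using finite_imp_inj_to_nat_seg by metis
  define enc_op where "enc_op = (\<lambda>(u, v, e :: 't list). (code \<kappa> u, code \<kappa> v, e))"
  have opA: "set u \<subseteq> A \<and> set v \<subseteq> A \<and> set e \<subseteq> Tm -` pV G" if "(u, v, e) \<in> ps_ops G" for u v e
  proof -
    have "set \<alpha> \<subseteq> pV G \<and> set \<beta> \<subseteq> pV G" if "(\<alpha>, \<beta>) \<in> pR G" for \<alpha> \<beta>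
      using G that by (auto simp: ps_grammar_def)
    then show ?thesis using that by (fastforce simp: ps_ops_def A_def)
  qed
  interpret bit_queue "enc_op ` ps_ops G" "code \<kappa> (queue_start G)" "code \<kappa> [None]" "Tm -` pV G"
  proof
    show "finite (enc_op ` ps_ops G)" using finite_ps_ops[OF G] by simp
    show "finite (Tm -` pV G)" using G by (intro finite_vimageI) (auto simp: ps_grammar_def inj_def)
    show "set e \<subseteq> Tm -` pV G" if m: "(u, v, e) \<in> enc_op ` ps_ops G" for u v e
    proof -
      obtain u' v' where "(u', v', e) \<in> ps_ops G" using m by (auto simp: enc_op_def)
      then show ?thesis using opA by blast
    qed
  qed (auto simp: framed_code queue_start_def enc_op_def simp del: code_simps(2), auto)
  have enc_ops: "pushes (map enc_op os) = code \<kappa> (pushes os)" "pops (map enc_op os) = code \<kappa> (pops os)"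
    "emits (map enc_op os) = emits os" for os
    by (induction os) (auto simp: enc_op_def)
  \<comment> \<open>Coding is a homomorphism and injective on words over \<open>A\<close>, so the
    equation for the coded run is equivalent to the original one.\<close>
  have "queue_start G @ pushes os = pops os @ [None] \<longleftrightarrow>
      code \<kappa> (queue_start G) @ pushes (map enc_op os) = pops (map enc_op os) @ code \<kappa> [None]"
    if "set os \<subseteq> ps_ops G" for os
  proof -
    have "set (pushes os) \<subseteq> A \<and> set (pops os) \<subseteq> A" using that
    proof (induction os)
      case (Cons p os)
      then show ?case using opA[of "fst p" "fst (snd p)" "snd (snd p)"] by (cases p) auto
    qed simp
    moreover have "set (queue_start G) \<subseteq> A" using G by (auto simp: A_def queue_start_def ps_grammar_def)
    moreover have "None \<in> A" by (simp add: A_def)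
    ultimately have "set (queue_start G @ pushes os) \<subseteq> A" "set (pops os @ [None]) \<subseteq> A" by auto
    from code_inj[OF \<kappa> this] show ?thesis
      unfolding enc_ops code_simps(3)[symmetric] by metis
  qed
  note eq = this
  have "target = ps_lang G"
    unfolding target_def ps_lang_queue[OF G]
  proof (intro set_eqI iffI)
    fix w assume "w \<in> {emits os |os. set os \<subseteq> enc_op ` ps_ops G \<and>
      code \<kappa> (queue_start G) @ pushes os = pops os @ code \<kappa> [None]}"
    then obtain os where os: "w = emits os" "set os \<subseteq> enc_op ` ps_ops G"
      "code \<kappa> (queue_start G) @ pushes os = pops os @ code \<kappa> [None]" by blast
    have "os \<in> lists (enc_op ` ps_ops G)" using os(2) by (auto simp: in_lists_conv_set)
    \<comment> \<open>Any choice of preimages will do, since coding leaves the output unchanged and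
      \<open>eq\<close> transfers the equation.\<close>
    then obtain os' where "os = map enc_op os'" "set os' \<subseteq> ps_ops G"
      unfolding lists_image by (auto simp: in_lists_conv_set)
    then show "w \<in> {emits os |os. set os \<subseteq> ps_ops G \<and> queue_start G @ pushes os = pops os @ [None]}"
      using os eq[of os'] enc_ops by auto
  next
    fix w assume "w \<in> {emits os |os. set os \<subseteq> ps_ops G \<and> queue_start G @ pushes os = pops os @ [None]}"
    then obtain os where "w = emits os" "set os \<subseteq> ps_ops G" "queue_start G @ pushes os = pops os @ [None]"
      by blast
    then show "w \<in> {emits os |os. set os \<subseteq> enc_op ` ps_ops G \<and>
      code \<kappa> (queue_start G) @ pushes os = pops os @ code \<kappa> [None]}"
      using eq[of os] enc_ops[of os] by (intro CollectI exI[of _ "map enc_op os"]) auto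
  qed
  then show "L \<in> SSCM (Some 3) (Some 1) (Some 4) (Some 3) (Some 3)"
    using target_in_SSCM L by simp
qed

theorem mainTheorem3:
  shows "(SSCM (Some 3) (Some 1) (Some 4) (Some 3) (Some 3) :: 't list set set) = RE"
  using SSCM_subset_RE RE_subset_SSCM by blast

end
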